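(* Let $G$ be a locally finite infinite graph satisfying Assumption $\mathcal{A}$, with connective constant $\sigma(G)>1$. Then for every $\lambda<\lambda_c(\sigma(G))$ there exists $\delta>0$ (depending on $\lambda$ and $G$) such that the normalized free energy of $G$ is unique and analytic on $\mathcal{L}_\delta([0,\lambda])$.
   Context: Assumption $\mathcal{A}$: $G=(V,E)$ is connected, locally finite and infinite, and there exist $d\ge1$ and commuting automorphisms $\tau_1,\dots,\tau_d$ of $G$ such that $(n_1,\dots,n_d)\mapsto\tau_1^{n_1}\cdots\tau_d^{n_d}$ is a group isomorphism from $\mathbb{Z}^d$ onto $\Gamma=\langle\tau_1,\dots,\tau_d\rangle$, the action of $\Gamma$ on $V$ is free (only the identity fixes any vertex), and there is a finite $F\subset V$ with $V=\Gamma F$. A self-avoiding walk of length $k$ from $v$ is a walk $v=v_0,\dots,v_k$ with distinct vertices; $\mathcal{N}_k(G,v)$ is their number, $\sigma_k(G)=\sup_v\mathcal{N}_k(G,v)^{1/k}$, $\sigma(G)=\limsup_k\sigma_k(G)$. For $x>1$, $\lambda_c(x)=x^x/(x-1)^{x+1}$. $\mathcal{L}_\delta(I)=\{z\in\mathbb{C}:|z-z_0|\le\delta\text{ for some }z_0\in I\}$. For finite $\Lambda\subset V$, $Z_\Lambda(z)=\sum_I z^{|I|}$ over independent sets $I\subseteq\Lambda$ of $G$. A Følner–van Hove sequence is a sequence of finite $\Lambda_n\subset V$ with $|\Lambda_n|\to\infty$ and $|\partial^{(r)}\Lambda_n|/|\Lambda_n|\to0$ for every $r\in\mathbb{N}$,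 where $\partial^{(r)}S=\{v\in V:\mathrm{dist}(v,S)\le r,\ \mathrm{dist}(v,V\setminus S)\le r\}$. "The normalized free energy is unique and analytic on $D$" means: all $Z_\Lambda$ are zero-free on $D$, and for every Følner–van Hove sequence $(\Lambda_n)$ the functions $|\Lambda_n|^{-1}\log Z_{\Lambda_n}(z)$ (branch continuous on $D$ with value $0$ at $0$) converge, uniformly on compact subsets of the interior of $D$, to an analytic function independent of the chosen sequence. *)

theory Defs
  imports "HOL-Complex_Analysis.Complex_Analysis" "HOL-Library.Liminf_Limsup"
begin

definition simple_graph :: "('a \<Rightarrow> 'a \<Rightarrow> bool) \<Rightarrow> bool" where
  "simple_graph adj \<longleftrightarrow> (\<forall>u v. adj u v \<longrightarrow> adj v u) \<and> (\<forall>v. \<not> adj v v)"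

definition graph_connected :: "('a \<Rightarrow> 'a \<Rightarrow> bool) \<Rightarrow> bool" where
  "graph_connected adj \<longleftrightarrow> (\<forall>u v. adj\<^sup>*\<^sup>* u v)"

definition locally_finite :: "('a \<Rightarrow> 'a \<Rightarrow> bool) \<Rightarrow> bool" where
  "locally_finite adj \<longleftrightarrow> (\<forall>v. finite {u. adj v u})"

definition graph_automorphism :: "('a \<Rightarrow> 'a \<Rightarrow> bool) \<Rightarrow> ('a \<Rightarrow> 'a) \<Rightarrow> bool" where
  "graph_automorphism adj f \<longleftrightarrow> bij f \<and> (\<forall>u v. adj u v \<longleftrightarrow> adj (f u) (f v))"

definition zpow :: "('a \<Rightarrow> 'a) \<Rightarrow> int \<Rightarrow> 'a \<Rightarrow> 'a" where
  "zpow f k = (if k \<ge> 0 then f ^^ nat k else (inv f) ^^ nat (- k))"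

definition zvecs :: "nat \<Rightarrow> (nat \<Rightarrow> int) set" where
  "zvecs d = {n. \<forall>i\<ge>d. n i = 0}"

definition zact :: "(nat \<Rightarrow> 'a \<Rightarrow> 'a) \<Rightarrow> nat \<Rightarrow> (nat \<Rightarrow> int) \<Rightarrow> 'a \<Rightarrow> 'a" where
  "zact \<tau> d n = foldr (\<lambda>i g. zpow (\<tau> i) (n i) \<circ> g) [0..<d] id"

inductive_set gen_group :: "(nat \<Rightarrow> 'a \<Rightarrow> 'a) \<Rightarrow> nat \<Rightarrow> ('a \<Rightarrow> 'a) set"
  for \<tau> d where
  gen_id: "id \<in> gen_group \<tau> d"
| gen_step: "g \<in> gen_group \<tau> d \<Longrightarrow> i < d \<Longrightarrow> \<tau> i \<circ> g \<in> gen_group \<tau> d"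
| gen_step_inv: "g \<in> gen_group \<tau> d \<Longrightarrow> i < d \<Longrightarrow> inv (\<tau> i) \<circ> g \<in> gen_group \<tau> d"

definition assumption_A :: "('a \<Rightarrow> 'a \<Rightarrow> bool) \<Rightarrow> bool" where
  "assumption_A adj \<longleftrightarrow>
     simple_graph adj \<and> graph_connected adj \<and> locally_finite adj \<and> infinite (UNIV :: 'a set) \<and>
     (\<exists>d::nat. \<exists>\<tau>::nat \<Rightarrow> 'a \<Rightarrow> 'a. d \<ge> 1 \<and>
        (\<forall>i<d. graph_automorphism adj (\<tau> i)) \<and>
        (\<forall>i<d. \<forall>j<d. \<tau> i \<circ> \<tau> j = \<tau> j \<circ> \<tau> i) \<comment> \<open>commuting\<close> \<and>
        \<comment> \<open>group isomorphism from \<open>\<int>\<^sup>d\<close> onto \<open>\<Gamma>\<close>\<close>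
        (\<forall>m\<in>zvecs d. \<forall>n\<in>zvecs d. zact \<tau> d (\<lambda>i. m i + n i) = zact \<tau> d m \<circ> zact \<tau> d n) \<and>
        inj_on (zact \<tau> d) (zvecs d) \<and>
        zact \<tau> d ` zvecs d = gen_group \<tau> d \<and>
        \<comment> \<open>free action\<close>
        (\<forall>g\<in>gen_group \<tau> d. \<forall>v. g v = v \<longrightarrow> g = id) \<and>
        \<comment> \<open>finitely many orbits\<close>
        (\<exists>F. finite F \<and> UNIV = {g v | g v. g \<in> gen_group \<tau> d \<and> v \<in> F}))"

definition saw :: "('a \<Rightarrow> 'a \<Rightarrow> bool) \<Rightarrow> nat \<Rightarrow> 'a \<Rightarrow> 'a list set" where
  "saw adj k v = {p. length p = Suc k \<and> p ! 0 = v \<and> distinct p \<and>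
                     (\<forall>i<k. adj (p ! i) (p ! Suc i))}"

definition num_saw :: "('a \<Rightarrow> 'a \<Rightarrow> bool) \<Rightarrow> nat \<Rightarrow> 'a \<Rightarrow> nat" where
  "num_saw adj k v = card (saw adj k v)"

definition sigma_k :: "('a \<Rightarrow> 'a \<Rightarrow> bool) \<Rightarrow> nat \<Rightarrow> ereal" where
  "sigma_k adj k = (SUP v. ereal (real (num_saw adj k v) powr (1 / real k)))"

definition conn_const :: "('a \<Rightarrow> 'a \<Rightarrow> bool) \<Rightarrow> ereal" where
  "conn_const adj = limsup (sigma_k adj)"

definition lambda_c :: "real \<Rightarrow> real" where
  "lambda_c x = x powr x / (x - 1) powr (x + 1)"

definition Ldelta :: "real \<Rightarrow> complex set \<Rightarrow> complex set" where
  "Ldelta \<delta> I = {z. \<exists>z0\<in>I. cmod (z - z0) \<le> \<delta>}"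

definition real_interval :: "real \<Rightarrow> complex set" where
  "real_interval lam = complex_of_real ` {0..lam}"

definition independent_set :: "('a \<Rightarrow> 'a \<Rightarrow> bool) \<Rightarrow> 'a set \<Rightarrow> bool" where
  "independent_set adj I \<longleftrightarrow> (\<forall>u\<in>I. \<forall>v\<in>I. \<not> adj u v)"

definition partition_fun :: "('a \<Rightarrow> 'a \<Rightarrow> bool) \<Rightarrow> 'a set \<Rightarrow> complex \<Rightarrow> complex" where
  "partition_fun adj \<Lambda> z = (\<Sum>I\<in>{I. I \<subseteq> \<Lambda> \<and> independent_set adj I}. z ^ card I)"

definition dist_le :: "('a \<Rightarrow> 'a \<Rightarrow> bool) \<Rightarrow> nat \<Rightarrow> 'a \<Rightarrow> 'a \<Rightarrow> bool" where
  "dist_le adj r u v \<longleftrightarrow> (\<exists>k\<le>r. (adj ^^ k) u v)"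

definition r_boundary :: "('a \<Rightarrow> 'a \<Rightarrow> bool) \<Rightarrow> nat \<Rightarrow> 'a set \<Rightarrow> 'a set" where
  "r_boundary adj r S = {v. (\<exists>u\<in>S. dist_le adj r v u) \<and> (\<exists>u\<in>UNIV - S. dist_le adj r v u)}"

definition folner_van_hove :: "('a \<Rightarrow> 'a \<Rightarrow> bool) \<Rightarrow> (nat \<Rightarrow> 'a set) \<Rightarrow> bool" where
  "folner_van_hove adj \<Lambda> \<longleftrightarrow>
     (\<forall>n. finite (\<Lambda> n)) \<and> filterlim (\<lambda>n. card (\<Lambda> n)) at_top sequentially \<and>
     (\<forall>r::nat. (\<lambda>n. real (card (r_boundary adj r (\<Lambda> n))) / real (card (\<Lambda> n))) \<longlonglongrightarrow> 0)"

text \<open>Normalized free energy unique and analytic on D. The branch of \<open>log Z\<^sub>\<Lambda>\<close> is any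
  continuous g on D with \<open>exp \<circ> g = Z\<^sub>\<Lambda>\<close> on D and \<open>g 0 = 0\<close>.\<close>
definition free_energy_unique_analytic :: "('a \<Rightarrow> 'a \<Rightarrow> bool) \<Rightarrow> complex set \<Rightarrow> bool" where
  "free_energy_unique_analytic adj D \<longleftrightarrow>
     (\<forall>\<Lambda>. finite \<Lambda> \<longrightarrow> (\<forall>z\<in>D. partition_fun adj \<Lambda> z \<noteq> 0)) \<and>
     (\<exists>f. f analytic_on interior D \<and>
        (\<forall>\<Lambda> g. folner_van_hove adj \<Lambda> \<longrightarrow>
           (\<forall>n. continuous_on D (g n) \<and> g n 0 = 0 \<and>
                (\<forall>z\<in>D. exp (g n z) = partition_fun adj (\<Lambda> n) z)) \<longrightarrow>
           (\<forall>K. compact K \<and> K \<subseteq> interior D \<longrightarrow>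
                uniform_limit K (\<lambda>n z. g n z / of_nat (card (\<Lambda> n))) f sequentially)))"

end

theory Submission
  imports Defs
begin

text \<open>
  Let \<open>R(S, v)\<close> be the ratio of the weights of the configurations on \<open>S \<union> {v}\<close> with \<open>v\<close>
  occupied and with \<open>v\<close> empty. Deleting the neighbours \<open>u\<^sub>1, \<dots>, u\<^sub>k\<close> of \<open>v\<close> in \<open>S\<close> one by one gives
  \<open>R(S, v) = z \<Prod>\<^sub>i 1 / (1 + R(S - {u\<^sub>1, \<dots>, u\<^sub>i}, u\<^sub>i))\<close>, and the iterated recursion runs along
  self-avoiding walks. For real \<open>\<lambda> \<le> \<lambda>\<^sub>c(\<Delta>)\<close> deviations measured in units of
  \<open>sqrt (R (1 + R))\<close> contract in the sense \<open>w\<^sup>q \<le> \<Delta>\<^sup>-\<^sup>1 \<Sum>\<^sub>i w\<^sub>i\<^sup>q\<close> for a suitable exponent \<open>q > 1\<close>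
  (the potential function of Sinclair, Srivastava, Stefankovic and Yin). If \<open>\<Delta> > \<sigma>\<close>, the number of
  walks does not beat the contraction, so for \<open>z\<close> near \<open>[0, \<lambda>]\<close> the ratio stays near its positive
  real value. Hence \<open>Z \<noteq> 0\<close>, and \<open>log Z\<close> is a sum of \<open>|\<Lambda>|\<close> bounded terms \<open>Ln (1 + R)\<close>.

  By Montel's theorem it remains to identify the limit of the derivatives
  \<open>Z' / Z = \<Sum>\<^sub>v Z(\<Lambda> - N[v]) / Z(\<Lambda>)\<close> per vertex near \<open>z = 0\<close>. There the summands depend on the
  \<open>r\<close>-ball around \<open>v\<close> up to an error \<open>O(2\<^sup>-\<^sup>r)\<close>, so they are asymptotically functions of the orbit
  of \<open>v\<close>, and along a Folner--van Hove sequence all orbits have the same density.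
\<close>

section \<open>Contraction of the tree recursion\<close>

text \<open>Vertex degrees may exceed \<Delta>, so one step of the recursion need not contract in
  the maximum norm. The inequality for \<open>q\<close>-th powers does not involve the number of
  children: every generation gains a factor \<open>1 / \<Delta>\<close> per walk, and iterating it
  produces the series of the numbers of walks of length \<open>k\<close> with weights close to
  \<open>\<Delta> ^ (- k)\<close>. It converges once \<Delta> exceeds the growth rate; \<Delta> is a
  real number \<open>D + 1\<close>, chosen slightly above the connective constant. A complex
  activity disturbs the step twice: through the nonlinearity of the product, and through
  \<open>z\<close> replacing the real activity, which adds an error in every generation. The first
  costs a factor close to 1, the second an additive term; both must fit into the room between the
  growth rate and \<Delta>. The admissible error is proportional to the real activity and
  degenerates at 0, where a crude disc takes over. Near 0 locality is elementary as well, and normal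
  families carry the limit found there to the whole domain.\<close>

lemma ln_one_plus_scale:
  fixes x y :: real
  assumes "0 < x" "x \<le> y"
  shows "x * ln (1 + y) \<le> y * ln (1 + x)"
proof -
  \<comment> \<open>Weighted AM-GM, with weight \<open>x / y\<close> on \<open>1 + y\<close> and the
    rest on 1: concavity of the logarithm in exponential form.\<close>
  have "(1 + y) powr (x / y) * 1 powr (1 - x / y) \<le> x / y * (1 + y) + (1 - x / y) * 1"
    using assms by (intro Youngs_inequality_0) (auto simp: field_simps)
  also have "\<dots> = 1 + x"
    using assms by (simp add: field_simps)
  finally have "(1 + y) powr (x / y) \<le> 1 + x"
    by simp
  then have "ln ((1 + y) powr (x / y)) \<le> ln (1 + x)"
    using assms by (subst ln_le_cancel_iff) auto
  then show ?thesis
    using assms by (simp add: ln_powr field_simps)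
qed

lemma max_of_deriv_sign:
  fixes f f' :: "real \<Rightarrow> real"
  assumes "a < m" "m < b"
    and der: "\<And>x. a < x \<Longrightarrow> x < b \<Longrightarrow> (f has_real_derivative f' x) (at x)"
    and up: "\<And>x. a < x \<Longrightarrow> x \<le> m \<Longrightarrow> f' x \<ge> 0"
    and down: "\<And>x. m \<le> x \<Longrightarrow> x < b \<Longrightarrow> f' x \<le> 0"
    and x: "a < x" "x < b"
  shows "f x \<le> f m"
proof (cases "x \<le> m")
  case True
  show ?thesis
    by (rule DERIV_nonneg_imp_nondecreasing[OF True]) (use der up x assms(2) in force)
next
  case False
  then have "m \<le> x" by simp
  then show ?thesis
    by (rule DERIV_nonpos_imp_nonincreasing) (use der down x assms(1) in force)
qed

text \<open>Normalising both sums to 1 reduces Hoelder's inequality to Young's inequality term by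
  term. Where normalisation fails, all terms vanish because
  \<open>0 powr \<alpha> = 0\<close>.\<close>

lemma holder_sum:
  fixes L W :: "'i \<Rightarrow> real"
  assumes fin: "finite I" and \<alpha>: "0 < \<alpha>" "0 < \<beta>" "\<alpha> + \<beta> = 1"
    and nn: "\<And>i. i \<in> I \<Longrightarrow> 0 \<le> L i" "\<And>i. i \<in> I \<Longrightarrow> 0 \<le> W i"
  shows "(\<Sum>i\<in>I. L i powr \<alpha> * W i powr \<beta>) \<le> (\<Sum>i\<in>I. L i) powr \<alpha> * (\<Sum>i\<in>I. W i) powr \<beta>"
proof -
  define A where "A = (\<Sum>i\<in>I. L i)"
  define B where "B = (\<Sum>i\<in>I. W i)"
  have AB: "0 \<le> A" "0 \<le> B"
    unfolding A_def B_def by (auto intro: sum_nonneg nn)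
  show ?thesis
  proof (cases "A = 0 \<or> B = 0")
    case True
    then have "L i powr \<alpha> * W i powr \<beta> = 0" if "i \<in> I" for i
      using that nn fin unfolding A_def B_def by (auto simp: sum_nonneg_eq_0_iff)
    then have "(\<Sum>i\<in>I. L i powr \<alpha> * W i powr \<beta>) = 0" by (intro sum.neutral) auto
    then show ?thesis by (metis mult_nonneg_nonneg powr_ge_zero)
  next
    case False
    with AB have AB: "A > 0" "B > 0" by auto
    have "L i powr \<alpha> * W i powr \<beta> \<le> (A powr \<alpha> * B powr \<beta>) * (\<alpha> * (L i / A) + \<beta> * (W i / B))"
      if i: "i \<in> I" for i
    proof (cases "L i = 0 \<or> W i = 0")
      case True
      then have "L i powr \<alpha> * W i powr \<beta> = 0" by auto
      also have "0 \<le> (A powr \<alpha> * B powr \<beta>) * (\<alpha> * (L i / A) + \<beta> * (W i / B))"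
        using AB \<alpha> nn[OF i] by (intro mult_nonneg_nonneg add_nonneg_nonneg) auto
      finally show ?thesis .
    next
      case False
      then have pos: "L i > 0" "W i > 0" using nn[OF i] by auto
      have "(L i / A) powr \<alpha> * (W i / B) powr \<beta> \<le> \<alpha> * (L i / A) + \<beta> * (W i / B)"
        using \<alpha> AB pos by (intro Youngs_inequality_0) auto
      then have "(A powr \<alpha> * B powr \<beta>) * ((L i / A) powr \<alpha> * (W i / B) powr \<beta>)
          \<le> (A powr \<alpha> * B powr \<beta>) * (\<alpha> * (L i / A) + \<beta> * (W i / B))"
        using AB by (intro mult_left_mono) auto
      moreover have "(A powr \<alpha> * B powr \<beta>) * ((L i / A) powr \<alpha> * (W i / B) powr \<beta>)
          = L i powr \<alpha> * W i powr \<beta>"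
        using AB pos by (simp add: powr_divide)
      ultimately show ?thesis by simp
    qed
    then have "(\<Sum>i\<in>I. L i powr \<alpha> * W i powr \<beta>)
        \<le> (\<Sum>i\<in>I. (A powr \<alpha> * B powr \<beta>) * (\<alpha> * (L i / A) + \<beta> * (W i / B)))"
      by (rule sum_mono)
    also have "\<dots> = (A powr \<alpha> * B powr \<beta>) * (\<alpha> * ((\<Sum>i\<in>I. L i) / A) + \<beta> * ((\<Sum>i\<in>I. W i) / B))"
      by (simp add: sum_distrib_left[symmetric] sum.distrib sum_divide_distrib[symmetric])
    also have "\<dots> = A powr \<alpha> * B powr \<beta>"
      using AB \<alpha> unfolding A_def[symmetric] B_def[symmetric] by simp
    finally show ?thesis unfolding A_def B_def .
  qed
qed

text \<open>
  The critical \<open>\<Delta>\<close>-ary tree with \<open>\<Delta> = D + 1\<close> has fixed point \<open>1 / D\<close>, where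
  \<open>t0 = ln (1 + 1 / D)\<close>. The exponent \<open>c = D * t0\<close> is the one for which both of the following
  one-variable functions are maximal at \<open>1 / D\<close>.
\<close>

lemma occupation_le_log_powr:
  fixes x D :: real
  assumes D: "D > 0" and x: "x \<ge> 0"
  defines "t0 \<equiv> ln (1 + 1 / D)" and "c \<equiv> D * ln (1 + 1 / D)"
  shows "x / (1 + x) \<le> (ln (1 + x) / t0) powr c / (D + 1)"
proof (cases "x = 0")
  case True
  then show ?thesis using D by simp
next
  case False
  with x have x: "x > 0" by simp
  have t0: "t0 > 0" using D unfolding t0_def by (intro ln_gt_zero) auto
  define F where "F = (\<lambda>x::real. ln x - ln (1 + x) - c * ln (ln (1 + x)))"
  \<comment> \<open>The sign of \<open>F'\<close> compares \<open>ln (1 + x) / x\<close>, which is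
    decreasing, with \<open>c\<close>, its value at \<open>1 / D\<close>.\<close>
  define F' where "F' = (\<lambda>x::real. (ln (1 + x) - c * x) / (x * (1 + x) * ln (1 + x)))"
  have "F x \<le> F (1 / D)"
  proof (rule max_of_deriv_sign[of 0 "1/D" "x + 1/D + 1" F F'])
    fix u :: real assume u: "0 < u" "u < x + 1/D + 1"
    have l: "ln (1 + u) > 0" using u by simp
    have "(F has_real_derivative (1 / u - 1 / (1 + u) - c * (1 / (1 + u) / ln (1 + u)))) (at u)"
      unfolding F_def using u l by (auto intro!: derivative_eq_intros)
    moreover have "1 / u - 1 / (1 + u) - c * (1 / (1 + u) / ln (1 + u)) = F' u"
      unfolding F'_def using u l by (simp add: divide_simps)
    ultimately show "(F has_real_derivative F' u) (at u)" by simp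
  next
    fix u :: real assume u: "0 < u" "u \<le> 1 / D"
    have "u * ln (1 + 1/D) \<le> 1/D * ln (1 + u)" using u by (rule ln_one_plus_scale)
    then have "c * u \<le> ln (1 + u)" using D by (simp add: c_def field_simps)
    then show "0 \<le> F' u" unfolding F'_def using u by simp
  next
    fix u :: real assume u: "1 / D \<le> u" "u < x + 1/D + 1"
    have u0: "u > 0" using u D by (smt (verit) zero_less_divide_1_iff)
    have "1/D * ln (1 + u) \<le> u * ln (1 + 1/D)" using u D by (intro ln_one_plus_scale) auto
    then have "c * u \<ge> ln (1 + u)" using D by (simp add: c_def field_simps)
    then show "0 \<ge> F' u" unfolding F'_def using u0 by (simp add: divide_nonpos_pos)
  qed (use D x in \<open>auto simp: add_pos_pos\<close>)
  moreover have "F (1 / D) = - ln (D + 1) - c * ln t0"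
  proof -
    have "1 + 1 / D = (D + 1) / D" using D by (simp add: field_simps)
    then have "ln (1 / D) - ln (1 + 1 / D) = - ln (D + 1)" using D by (simp add: ln_div)
    then show ?thesis unfolding F_def t0_def by simp
  qed
  ultimately have "ln x - ln (1 + x) \<le> c * (ln (ln (1 + x)) - ln t0) - ln (D + 1)"
    by (simp add: F_def algebra_simps)
  then have "ln (x / (1 + x)) \<le> ln ((ln (1 + x) / t0) powr c / (D + 1))"
    using x D t0 by (simp add: ln_div ln_powr)
  then show ?thesis
    using x D t0 by (subst (asm) ln_le_cancel_iff) auto
qed

text \<open>The critical activity is the one whose \<open>D + 1\<close>-fold recursion has the fixed
  point \<open>1 / D\<close>: it equals \<open>1 / D\<close> times the power \<open>D + 1\<close> of
  \<open>1 + 1 / D\<close>. The logarithm of this is the second formula.\<close>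

lemma lambda_c_eq:
  assumes "D > 0"
  shows "lambda_c (D + 1) > 0" and "ln (lambda_c (D + 1)) = (D + 1) * ln (1 + 1 / D) - ln D"
proof -
  show "lambda_c (D + 1) > 0" using assms by (simp add: lambda_c_def)
  have "ln (lambda_c (D + 1)) = (D + 1) * ln (D + 1) - (D + 2) * ln D"
    using assms by (simp add: lambda_c_def ln_div ln_powr algebra_simps)
  moreover have "ln (1 + 1 / D) = ln (D + 1) - ln D"
  proof -
    have "1 + 1 / D = (D + 1) / D" using assms by (simp add: field_simps)
    then show ?thesis using assms by (simp add: ln_div)
  qed
  ultimately show "ln (lambda_c (D + 1)) = (D + 1) * ln (1 + 1 / D) - ln D"
    by (simp only:) (simp add: algebra_simps)
qed

text \<open>The parent's share of the contraction: \<open>ln (lambda_c (D + 1) / f)\<close> will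
  bound the sum of \<open>ln (1 + x i)\<close> over the children. Equality holds at
  \<open>f = 1 / D\<close>.\<close>

lemma occupation_times_log_powr_le:
  fixes f D :: real
  assumes D: "D > 0" and f: "0 < f" "f \<le> lambda_c (D + 1)"
  defines "t0 \<equiv> ln (1 + 1 / D)" and "c \<equiv> D * ln (1 + 1 / D)"
  shows "f / (1 + f) * (ln (lambda_c (D + 1) / f) / t0) powr c \<le> (D + 1) powr (c - 1)"
proof (cases "f = lambda_c (D + 1)")
  case True
  then show ?thesis using f by simp
next
  case False
  define l where "l = lambda_c (D + 1)"
  have l: "l > 0" "ln l = (D + 1) * t0 - ln D"
    using lambda_c_eq[OF D] by (auto simp: l_def t0_def)
  have f: "0 < f" "f < l" using f False by (auto simp: l_def)
  have t0: "t0 > 0" using D unfolding t0_def by (intro ln_gt_zero) auto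
  have c: "c > 0" "c = D * t0" using D t0 by (auto simp: c_def t0_def)
  have lD: "ln (l / (1 / D)) = (D + 1) * t0"
    using l D by (simp add: ln_mult)
  then have "ln (l / (1 / D)) > 0" using D t0 by simp
  then have Dl: "1 / D < l" using l D by (simp add: field_simps)
  define F where "F = (\<lambda>x::real. ln x - ln (1 + x) + c * ln (ln l - ln x))"
  \<comment> \<open>The numerator is decreasing and vanishes at \<open>1 / D\<close>, since there
    \<open>ln l - ln x = (D + 1) * t0 = c * (1 + x)\<close>.\<close>
  define F' where "F' = (\<lambda>x::real. (ln l - ln x - c * (1 + x)) / (x * (1 + x) * (ln l - ln x)))"
  have "F f \<le> F (1 / D)"
  proof (rule max_of_deriv_sign[of 0 "1/D" l F F'])
    fix u :: real assume u: "0 < u" "u < l"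
    have lu: "ln l - ln u > 0" using u by simp
    have "(F has_real_derivative (1 / u - 1 / (1 + u) + c * ((0 - 1 / u) / (ln l - ln u)))) (at u)"
      unfolding F_def using u lu by (auto intro!: derivative_eq_intros)
    moreover have "1 / u - 1 / (1 + u) + c * ((0 - 1 / u) / (ln l - ln u)) = F' u"
      unfolding F'_def using u lu by (simp add: divide_simps)
    ultimately show "(F has_real_derivative F' u) (at u)" by simp
  next
    fix u :: real assume u: "0 < u" "u \<le> 1 / D"
    have "ln u \<le> ln (1 / D)" using u D by (subst ln_le_cancel_iff) auto
    then have "ln u \<le> - ln D" using D by (simp add: ln_div)
    moreover have "c * u \<le> t0"
      using u D t0 by (simp add: c field_simps)
    ultimately have "ln l - ln u - c * (1 + u) \<ge> 0"
      using l c by (simp add: algebra_simps)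
    moreover have "ln u < ln l" using u Dl by simp
    ultimately show "0 \<le> F' u" unfolding F'_def using u by simp
  next
    fix u :: real assume u: "1 / D \<le> u" "u < l"
    have u0: "u > 0" using u D by (smt (verit) zero_less_divide_1_iff)
    have "ln u \<ge> ln (1 / D)" using u u0 D by (subst ln_le_cancel_iff) auto
    then have "ln u \<ge> - ln D" using D by (simp add: ln_div)
    moreover have "c * u \<ge> t0"
      using u D t0 by (simp add: c field_simps)
    ultimately have "ln l - ln u - c * (1 + u) \<le> 0"
      using l c by (simp add: algebra_simps)
    moreover have "ln u < ln l" using u u0 by simp
    ultimately show "0 \<ge> F' u" unfolding F'_def using u0 by (simp add: divide_nonpos_pos)
  qed (use D f Dl in auto)
  also have "F (1 / D) = (c - 1) * ln (D + 1) + c * ln t0"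
  proof -
    have "1 + 1 / D = (D + 1) / D" using D by (simp add: field_simps)
    then have 1: "ln (1 / D) - ln (1 + 1 / D) = - ln (D + 1)" using D by (simp add: ln_div)
    have "ln l - ln (1 / D) = (D + 1) * t0" using lD l D by (simp add: ln_div)
    then have "ln (ln l - ln (1 / D)) = ln (D + 1) + ln t0"
      using D t0 by (simp add: ln_mult)
    with 1 show ?thesis unfolding F_def by (simp add: algebra_simps)
  qed
  finally have *: "ln f - ln (1 + f) + c * (ln (ln l - ln f) - ln t0) \<le> (c - 1) * ln (D + 1)"
    by (simp add: F_def algebra_simps)
  have lf: "ln l - ln f > 0" using f by simp
  have ldiv: "ln (l / f) = ln l - ln f" using f l by (simp add: ln_div)
  have "ln (f / (1 + f) * (ln (l / f) / t0) powr c) \<le> ln ((D + 1) powr (c - 1))"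
    using f l D t0 lf * by (simp add: ldiv ln_div ln_mult ln_powr)
  moreover have "f / (1 + f) * (ln (l / f) / t0) powr c > 0"
    using f lf t0 by (simp add: ldiv)
  ultimately show ?thesis
    using D unfolding l_def by (subst (asm) ln_le_cancel_iff) auto
qed

text \<open>To first order, a deviation \<open>sqrt (x i * (1 + x i)) * w i\<close> of a child
  changes \<open>ln f\<close> by \<open>sqrt (x i / (1 + x i)) * w i\<close>, and a relative change
  of \<open>f\<close> counts \<open>sqrt (f / (1 + f))\<close> times in units of
  \<open>sqrt (f * (1 + f))\<close>. So the left side is the propagated deviation for
  \<open>w i = T i powr \<beta>\<close>. Hoelder with exponents \<open>c / 2 + \<beta> = 1\<close>
  separates the children's occupations from \<open>T\<close>; the sum of \<open>ln (1 + x i)\<close>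
  is fixed by \<open>f\<close> and \<open>l0\<close>, and the number of children drops out.\<close>

lemma tree_recursion_contraction:
  fixes x T :: "'i \<Rightarrow> real" and D l0 :: real
  assumes fin: "finite I" and D: "D > 0" and l0: "0 < l0" "l0 \<le> lambda_c (D + 1)"
    and x: "\<And>i. i \<in> I \<Longrightarrow> x i \<ge> 0" and T: "\<And>i. i \<in> I \<Longrightarrow> T i \<ge> 0"
  defines "\<beta> \<equiv> 1 - D * ln (1 + 1 / D) / 2"
  defines "f \<equiv> l0 * (\<Prod>i\<in>I. inverse (1 + x i))"
  shows "sqrt (f / (1 + f)) * (\<Sum>i\<in>I. sqrt (x i / (1 + x i)) * T i powr \<beta>)
           \<le> (D + 1) powr (- \<beta>) * (\<Sum>i\<in>I. T i) powr \<beta>"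
proof -
  define t0 where "t0 = ln (1 + 1 / D)"
  define c where "c = D * ln (1 + 1 / D)"
  have t0: "t0 > 0" using D unfolding t0_def by (intro ln_gt_zero) auto
  have "ln (1 + 1 / D) < 1 / D" using D by (intro ln_add_one_self_less_self) auto
  then have c: "0 < c" "c < 1" using D t0 by (auto simp: c_def t0_def field_simps)
  have \<beta>: "\<beta> = 1 - c / 2" "\<beta> > 0" using c by (auto simp: \<beta>_def c_def)
  define L where "L = (\<lambda>i. ln (1 + x i) / t0)"
  have L: "L i \<ge> 0" if "i \<in> I" for i using x[OF that] t0 by (simp add: L_def)
  have sq: "sqrt (x i / (1 + x i)) \<le> L i powr (c / 2) * (D + 1) powr (-1/2)" if i: "i \<in> I" for i
  proof -
    have "sqrt (x i / (1 + x i)) \<le> sqrt (L i powr c / (D + 1))"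
      using occupation_le_log_powr[OF D x[OF i]] by (simp add: L_def t0_def c_def)
    also have "\<dots> = L i powr (c / 2) * (D + 1) powr (-1/2)"
      using D L[OF i] by (simp add: real_sqrt_divide powr_half_sqrt_powr[symmetric] powr_minus_divide powr_half_sqrt)
    finally show ?thesis .
  qed
  have "(\<Sum>i\<in>I. sqrt (x i / (1 + x i)) * T i powr \<beta>)
      \<le> (\<Sum>i\<in>I. L i powr (c / 2) * (D + 1) powr (-1/2) * T i powr \<beta>)"
    by (intro sum_mono mult_right_mono sq) auto
  also have "\<dots> = (D + 1) powr (-1/2) * (\<Sum>i\<in>I. L i powr (c / 2) * T i powr \<beta>)"
    by (simp add: sum_distrib_left mult_ac)
  also have "\<dots> \<le> (D + 1) powr (-1/2) * ((\<Sum>i\<in>I. L i) powr (c / 2) * (\<Sum>i\<in>I. T i) powr \<beta>)"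
    using c \<beta> L T fin by (intro mult_left_mono holder_sum) auto
  finally have A: "(\<Sum>i\<in>I. sqrt (x i / (1 + x i)) * T i powr \<beta>)
      \<le> (D + 1) powr (-1/2) * ((\<Sum>i\<in>I. L i) powr (c / 2) * (\<Sum>i\<in>I. T i) powr \<beta>)" .
  have pp: "(\<Prod>i\<in>I. inverse (1 + x i)) > 0"
    using x by (intro prod_pos) (auto simp: add_pos_nonneg)
  then have f0: "f > 0" using l0 by (simp add: f_def)
  have "(\<Prod>i\<in>I. inverse (1 + x i)) \<le> 1"
  proof (rule prod_le_1)
    fix i assume "i \<in> I"
    then show "0 \<le> inverse (1 + x i) \<and> inverse (1 + x i) \<le> 1"
      using x[of i] by (auto simp: inverse_eq_divide)
  qed
  then have "f \<le> l0" using l0 by (simp add: f_def mult_left_le)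
  with l0 have fl: "f \<le> lambda_c (D + 1)" by simp
  have "ln f = ln l0 + (\<Sum>i\<in>I. ln (inverse (1 + x i)))"
  proof -
    have "ln (\<Prod>i\<in>I. inverse (1 + x i)) = (\<Sum>i\<in>I. ln (inverse (1 + x i)))"
      using x fin by (intro ln_prod) (auto simp: add_nonneg_eq_0_iff)
    then show ?thesis unfolding f_def using l0 pp by (subst ln_mult) auto
  qed
  also have "(\<Sum>i\<in>I. ln (inverse (1 + x i))) = - (\<Sum>i\<in>I. ln (1 + x i))"
    using x by (auto simp: sum_negf[symmetric] ln_inverse intro!: sum.cong)
  finally have "(\<Sum>i\<in>I. ln (1 + x i)) = ln l0 - ln f" by simp
  also have "\<dots> \<le> ln (lambda_c (D + 1) / f)"
    using l0 f0 by (simp add: ln_div)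
  finally have "(\<Sum>i\<in>I. L i) \<le> ln (lambda_c (D + 1) / f) / t0"
    using t0 by (simp add: L_def sum_divide_distrib[symmetric] divide_right_mono)
  then have S: "(\<Sum>i\<in>I. L i) powr (c / 2) \<le> (ln (lambda_c (D + 1) / f) / t0) powr (c / 2)"
    using c L by (intro powr_mono2) (auto intro: sum_nonneg)
  have l_nn: "ln (lambda_c (D + 1) / f) / t0 \<ge> 0"
    using fl f0 t0 by simp
  have "sqrt (f / (1 + f)) * (ln (lambda_c (D + 1) / f) / t0) powr (c / 2)
      = sqrt (f / (1 + f) * (ln (lambda_c (D + 1) / f) / t0) powr c)"
    by (simp only: real_sqrt_mult powr_half_sqrt_powr[OF l_nn])
  also have "\<dots> \<le> sqrt ((D + 1) powr (c - 1))"
    using occupation_times_log_powr_le[OF D f0 fl] by (simp add: t0_def c_def)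
  also have "\<dots> = (D + 1) powr ((c - 1) / 2)"
    using D by (simp add: powr_half_sqrt_powr)
  finally have B: "sqrt (f / (1 + f)) * (ln (lambda_c (D + 1) / f) / t0) powr (c / 2)
    \<le> (D + 1) powr ((c - 1) / 2)" .
  have "sqrt (f / (1 + f)) * (\<Sum>i\<in>I. sqrt (x i / (1 + x i)) * T i powr \<beta>)
      \<le> sqrt (f / (1 + f)) * ((D + 1) powr (-1/2) * ((ln (lambda_c (D + 1) / f) / t0) powr (c / 2) * (\<Sum>i\<in>I. T i) powr \<beta>))"
    using f0 by (intro mult_left_mono order_trans[OF A] mult_right_mono S) auto
  also have "\<dots> = (D + 1) powr (-1/2) * (sqrt (f / (1 + f)) * (ln (lambda_c (D + 1) / f) / t0) powr (c / 2)) * (\<Sum>i\<in>I. T i) powr \<beta>"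
    by (simp add: mult_ac)
  also have "\<dots> \<le> (D + 1) powr (-1/2) * (D + 1) powr ((c - 1) / 2) * (\<Sum>i\<in>I. T i) powr \<beta>"
    using B by (intro mult_right_mono mult_left_mono) auto
  also have "(D + 1) powr (-1/2) * (D + 1) powr ((c - 1) / 2) = (D + 1) powr (- \<beta>)"
  proof -
    have "-1/2 + (c - 1) / 2 = - \<beta>" using \<beta> by (simp add: field_simps)
    then show ?thesis by (simp only: powr_add[symmetric])
  qed
  finally show ?thesis .
qed

section \<open>From real to complex activities\<close>

text \<open>Written as \<open>1 / (1 - s) - 1\<close>, the bound survives the induction because
  \<open>(1 - s) * (1 - a) \<ge> 1 - (a + s)\<close>.\<close>

lemma norm_prod_inverse_minus_one:
  fixes t :: "'i \<Rightarrow> complex"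
  assumes "finite I" "(\<Sum>i\<in>I. cmod (t i)) < 1"
  shows "cmod ((\<Prod>i\<in>I. inverse (1 + t i)) - 1)
           \<le> (\<Sum>i\<in>I. cmod (t i)) / (1 - (\<Sum>i\<in>I. cmod (t i)))"
  using assms
proof (induction I)
  case empty
  then show ?case by simp
next
  case (insert j I)
  define s where "s = (\<Sum>i\<in>I. cmod (t i))"
  define a where "a = cmod (t j)"
  define P where "P = (\<Prod>i\<in>I. inverse (1 + t i))"
  have nn: "s \<ge> 0" "a \<ge> 0" by (auto simp: s_def a_def intro: sum_nonneg)
  have lt: "a + s < 1" using insert by (simp add: s_def a_def)
  have IH: "cmod (P - 1) \<le> s / (1 - s)"
    using insert.IH lt nn unfolding s_def P_def a_def by simp
  have sd: "s / (1 - s) \<ge> 0" using lt nn by simp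
  have n1: "cmod (1 + t j) \<ge> 1 - a"
    unfolding a_def by (metis norm_one norm_triangle_ineq2 norm_minus_cancel diff_minus_eq_add)
  then have nz: "1 + t j \<noteq> 0" using lt nn by auto
  have "(\<Prod>i\<in>insert j I. inverse (1 + t i)) - 1 = (P - 1 - t j) / (1 + t j)"
    using insert nz by (simp add: P_def field_simps)
  then have "cmod ((\<Prod>i\<in>insert j I. inverse (1 + t i)) - 1) = cmod (P - 1 - t j) / cmod (1 + t j)"
    by (simp add: norm_divide)
  also have "\<dots> \<le> (s / (1 - s) + a) / (1 - a)"
    using n1 lt nn IH sd by (intro frac_le order_trans[OF norm_triangle_ineq4]) (auto simp: a_def)
  also have "\<dots> = 1 / ((1 - s) * (1 - a)) - 1"
  proof -
    have "1 - s \<noteq> 0" "1 - a \<noteq> 0" using lt nn by auto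
    then show ?thesis by (simp add: divide_simps) (simp add: algebra_simps)
  qed
  also have "\<dots> \<le> 1 / (1 - (a + s)) - 1"
  proof -
    have "1 - (a + s) \<le> (1 - s) * (1 - a)" using nn by (simp add: algebra_simps)
    then show ?thesis using lt by (simp add: frac_le)
  qed
  also have "\<dots> = (a + s) / (1 - (a + s))" using lt by (simp add: field_simps)
  finally show ?case using insert by (simp add: s_def a_def)
qed

text \<open>With relative errors, \<open>1 + y i = (1 + x i) * (1 + t i)\<close>, the quotient
  \<open>g / f\<close> is exactly \<open>z / l0\<close> times the product of the inverses of
  \<open>1 + t i\<close>, so no derivative at an intermediate point is needed. The hypothesis
  linking \<eta>, \<open>e\<close> and \<epsilon> lets the single factor \<open>1 + e\<close> cover
  both \<open>cmod (z / l0) \<le> 1 + \<eta>\<close> and the higher-order factor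
  \<open>1 / (1 - s)\<close>.\<close>

lemma complex_recursion_step:
  fixes x T :: "'i \<Rightarrow> real" and y :: "'i \<Rightarrow> complex" and D l0 e \<eta> \<epsilon> :: real and z :: complex
  assumes fin: "finite I" and cardI: "card I \<le> m"
    and D: "D > 0" and l0: "0 < l0" "l0 \<le> lambda_c (D + 1)"
    and x: "\<And>i. i \<in> I \<Longrightarrow> x i \<ge> 0" and T: "\<And>i. i \<in> I \<Longrightarrow> T i \<ge> 0"
    and y: "\<And>i. i \<in> I \<Longrightarrow> cmod (y i - of_real (x i)) \<le> sqrt (x i * (1 + x i)) * T i powr \<beta>"
    and small: "\<And>i. i \<in> I \<Longrightarrow> T i powr \<beta> \<le> \<epsilon>"
    and z: "cmod (z - of_real l0) \<le> l0 * \<eta>"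
    and e: "e > 0" "0 \<le> \<eta>" "1 + \<eta> \<le> (1 + e) * (1 - real m * \<epsilon>)" "0 \<le> \<epsilon>"
    and \<beta>_def: "\<beta> = 1 - D * ln (1 + 1 / D) / 2"
    and f_def: "f = l0 * (\<Prod>i\<in>I. inverse (1 + x i))"
    and g_def: "g = z * (\<Prod>i\<in>I. inverse (1 + y i))"
  shows "cmod (g - of_real f)
    \<le> sqrt (f * (1 + f)) * ((1 + e) * ((D + 1) powr (- \<beta>) * (\<Sum>i\<in>I. T i) powr \<beta>) + \<eta>)"
proof -
  define t where "t = (\<lambda>i. (y i - of_real (x i)) / of_real (1 + x i))"
  have yt: "1 + y i = of_real (1 + x i) * (1 + t i)" if "i \<in> I" for i
  proof -
    have "complex_of_real (1 + x i) \<noteq> 0"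
      using x[OF that] by (simp only: of_real_eq_0_iff)
    then show ?thesis by (simp add: t_def distrib_left)
  qed
  define s where "s = (\<Sum>i\<in>I. cmod (t i))"
  have t_le: "cmod (t i) \<le> sqrt (x i / (1 + x i)) * T i powr \<beta>" if i: "i \<in> I" for i
  proof -
    have "cmod (t i) = cmod (y i - of_real (x i)) / (1 + x i)"
      using x[OF i] unfolding t_def norm_divide norm_of_real by simp
    also have "\<dots> \<le> sqrt (x i * (1 + x i)) * T i powr \<beta> / (1 + x i)"
      using x[OF i] y[OF i] by (intro divide_right_mono) auto
    also have "sqrt (x i * (1 + x i)) / (1 + x i) = sqrt (x i / (1 + x i))"
    proof -
      have "sqrt (1 + x i) / (1 + x i) = inverse (sqrt (1 + x i))"
        using x[OF i] by (intro sqrt_divide_self_eq) simp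
      then show ?thesis
        by (metis real_sqrt_mult real_sqrt_divide times_divide_eq_right divide_inverse)
    qed
    then have "sqrt (x i * (1 + x i)) * T i powr \<beta> / (1 + x i) = sqrt (x i / (1 + x i)) * T i powr \<beta>"
      by (metis times_divide_eq_left)
    finally show ?thesis .
  qed
  have "cmod (t i) \<le> \<epsilon>" if i: "i \<in> I" for i
  proof -
    have "sqrt (x i / (1 + x i)) \<le> 1" using x[OF i] by simp
    then have "sqrt (x i / (1 + x i)) * T i powr \<beta> \<le> 1 * T i powr \<beta>" by (intro mult_right_mono) auto
    with t_le[OF i] small[OF i] show ?thesis by simp
  qed
  then have "s \<le> (\<Sum>i\<in>I. \<epsilon>)" unfolding s_def by (rule sum_mono)
  also have "\<dots> \<le> real m * \<epsilon>" using cardI e by (simp add: mult_right_mono)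
  finally have s_m: "s \<le> real m * \<epsilon>" .
  have s0: "s \<ge> 0" unfolding s_def by (intro sum_nonneg) auto
  have "1 - real m * \<epsilon> > 0" using e by (smt (verit) mult_nonneg_nonpos)
  then have s1: "s < 1" using s_m by simp
  define P where "P = (\<Prod>i\<in>I. inverse (1 + t i))"
  have P: "cmod (P - 1) \<le> s / (1 - s)"
    unfolding P_def s_def by (rule norm_prod_inverse_minus_one) (use fin s1 s_def in auto)
  have pos: "(\<Prod>i\<in>I. inverse (1 + x i)) > 0"
    using x by (intro prod_pos) (auto simp: add_pos_nonneg)
  then have f0: "f > 0" using l0 by (simp add: f_def)
  have "(\<Prod>i\<in>I. inverse (1 + y i)) = (\<Prod>i\<in>I. of_real (inverse (1 + x i)) * inverse (1 + t i))"
    by (intro prod.cong refl) (simp add: yt)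
  also have "\<dots> = of_real (\<Prod>i\<in>I. inverse (1 + x i)) * P"
    unfolding P_def prod.distrib by simp
  finally have "g - of_real f = of_real f * ((z / of_real l0) * (P - 1) + (z / of_real l0 - 1))"
    using l0 by (simp add: g_def f_def field_simps)
  then have "cmod (g - of_real f) = f * cmod ((z / of_real l0) * (P - 1) + (z / of_real l0 - 1))"
    using f0 by (simp add: norm_mult)
  also have "\<dots> \<le> f * (cmod (z / of_real l0) * cmod (P - 1) + cmod (z / of_real l0 - 1))"
    using f0 by (intro mult_left_mono order_trans[OF norm_triangle_ineq]) (auto simp: norm_mult norm_divide)
  also have "\<dots> \<le> f * ((1 + e) * s + \<eta>)"
  proof -
    have "z / of_real l0 - 1 = (z - of_real l0) / of_real l0" using l0 by (simp add: field_simps)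
    then have "cmod (z / of_real l0 - 1) = cmod (z - of_real l0) / l0"
      using l0 by (simp add: norm_divide)
    also have "\<dots> \<le> \<eta>" using z l0 by (simp add: field_simps)
    finally have z1: "cmod (z / of_real l0 - 1) \<le> \<eta>" .
    have "cmod (z / of_real l0) \<le> cmod (z / of_real l0 - 1) + cmod 1"
      by (metis diff_add_cancel norm_triangle_ineq)
    with z1 have "cmod (z / of_real l0) \<le> 1 + \<eta>" by simp
    then have "cmod (z / of_real l0) * cmod (P - 1) \<le> (1 + \<eta>) * (s / (1 - s))"
      using P e by (intro mult_mono) auto
    also have "\<dots> \<le> ((1 + e) * (1 - s)) * (s / (1 - s))"
    proof (rule mult_right_mono)
      have "(1 + e) * (1 - real m * \<epsilon>) \<le> (1 + e) * (1 - s)"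
        using e s_m by (intro mult_left_mono) auto
      then show "1 + \<eta> \<le> (1 + e) * (1 - s)" by (rule order_trans[OF e(3)])
    qed (use s0 s1 in auto)
    also have "\<dots> = (1 + e) * s" using s1 by simp
    finally show ?thesis using z1 f0 by (intro mult_left_mono add_mono) auto
  qed
  also have "\<dots> = sqrt (f * (1 + f)) * (sqrt (f / (1 + f)) * ((1 + e) * s + \<eta>))"
  proof -
    have "sqrt (f * (1 + f)) * sqrt (f / (1 + f)) = sqrt ((f * (1 + f)) * (f / (1 + f)))"
      by (rule real_sqrt_mult[symmetric])
    also have "(f * (1 + f)) * (f / (1 + f)) = f\<^sup>2" using f0 by (simp add: power2_eq_square)
    finally have "sqrt (f * (1 + f)) * sqrt (f / (1 + f)) = f" using f0 by simp
    then show ?thesis by (simp only: mult.assoc[symmetric])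
  qed
  also have "\<dots> \<le> sqrt (f * (1 + f)) * ((1 + e) * ((D + 1) powr (- \<beta>) * (\<Sum>i\<in>I. T i) powr \<beta>) + \<eta>)"
  proof (rule mult_left_mono)
    have "s \<le> (\<Sum>i\<in>I. sqrt (x i / (1 + x i)) * T i powr \<beta>)"
      unfolding s_def by (intro sum_mono t_le)
    then have "sqrt (f / (1 + f)) * s \<le> sqrt (f / (1 + f)) * (\<Sum>i\<in>I. sqrt (x i / (1 + x i)) * T i powr \<beta>)"
      using f0 by (intro mult_left_mono) auto
    also have "\<dots> \<le> (D + 1) powr (- \<beta>) * (\<Sum>i\<in>I. T i) powr \<beta>"
      using tree_recursion_contraction[OF fin D l0 x T] by (simp add: \<beta>_def f_def)
    finally have 1: "sqrt (f / (1 + f)) * s \<le> (D + 1) powr (- \<beta>) * (\<Sum>i\<in>I. T i) powr \<beta>" .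
    have 2: "sqrt (f / (1 + f)) * \<eta> \<le> 1 * \<eta>"
      using f0 e by (intro mult_right_mono) auto
    have "sqrt (f / (1 + f)) * ((1 + e) * s + \<eta>) = (1 + e) * (sqrt (f / (1 + f)) * s) + sqrt (f / (1 + f)) * \<eta>"
      by (simp add: algebra_simps)
    also have "\<dots> \<le> (1 + e) * ((D + 1) powr (- \<beta>) * (\<Sum>i\<in>I. T i) powr \<beta>) + \<eta>"
      using 1 2 e by (intro add_mono mult_left_mono) auto
    finally show "sqrt (f / (1 + f)) * ((1 + e) * s + \<eta>)
        \<le> (1 + e) * ((D + 1) powr (- \<beta>) * (\<Sum>i\<in>I. T i) powr \<beta>) + \<eta>" .
  qed (use f0 in auto)
  finally show ?thesis .
qed

text \<open>Moving the error \<eta> inside the power turns the step into a linear recursion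
  \<open>\<nu> * X + B\<close>, which can be summed over walks. A small error relative to the main
  term costs a second factor \<open>1 + e\<close>, hence the exponent \<open>2 / \<beta>\<close>;
  otherwise the main term is itself at most a multiple of the error.\<close>

lemma absorb_error_powr:
  fixes X \<beta> e \<eta> E :: real
  assumes "X \<ge> 0" "0 < \<beta>" "e > 0" "\<eta> \<ge> 0" "E > 0"
  shows "(1 + e) * (E powr (- \<beta>) * X powr \<beta>) + \<eta>
           \<le> ((1 + e) powr (2 / \<beta>) / E * X + ((1 + 1 / e) * \<eta>) powr (1 / \<beta>)) powr \<beta>"
proof -
  define A where "A = (1 + e) * (E powr (- \<beta>) * X powr \<beta>)"
  define Y where "Y = (1 + e) powr (2 / \<beta>) / E * X"
  define B where "B = ((1 + 1 / e) * \<eta>) powr (1 / \<beta>)"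
  have nn: "Y \<ge> 0" "B \<ge> 0" using assms by (auto simp: Y_def B_def)
  have "((1 + e) powr (2 / \<beta>)) powr \<beta> = (1 + e) powr 2"
    using assms by (simp add: powr_powr)
  also have "\<dots> = (1 + e) * (1 + e)"
    using assms by (simp add: power2_eq_square)
  finally have "((1 + e) powr (2 / \<beta>)) powr \<beta> = (1 + e) * (1 + e)" .
  then have YA: "Y powr \<beta> = (1 + e) * A"
    unfolding Y_def A_def powr_mult powr_divide powr_minus_divide by simp
  have BA: "B powr \<beta> = (1 + 1 / e) * \<eta>"
    unfolding B_def using assms by (simp add: powr_powr)
  have "A + \<eta> \<le> (Y + B) powr \<beta>"
  proof (cases "\<eta> \<le> e * A")
    case True
    then have "A + \<eta> \<le> Y powr \<beta>" by (simp add: YA algebra_simps)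
    also have "\<dots> \<le> (Y + B) powr \<beta>"
      using assms nn by (intro powr_mono2) auto
    finally show ?thesis .
  next
    case False
    then have "A + \<eta> \<le> B powr \<beta>" using assms by (simp add: BA field_simps)
    also have "\<dots> \<le> (Y + B) powr \<beta>"
      using assms nn by (intro powr_mono2) auto
    finally show ?thesis .
  qed
  then show ?thesis by (simp add: A_def Y_def B_def)
qed

section \<open>Occupation ratios and self-avoiding walks\<close>

abbreviation nbrs :: "('a \<Rightarrow> 'a \<Rightarrow> bool) \<Rightarrow> 'a \<Rightarrow> 'a set" where
  "nbrs adj v \<equiv> {u. adj v u}"

definition hc_ratio :: "('a \<Rightarrow> 'a \<Rightarrow> bool) \<Rightarrow> 'a set \<Rightarrow> 'a \<Rightarrow> complex \<Rightarrow> complex" where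
  "hc_ratio adj S v z = z * partition_fun adj (S - nbrs adj v) z / partition_fun adj S z"

lemma partition_fun_empty [simp]: "partition_fun adj {} z = 1"
proof -
  have "{I. I \<subseteq> {} \<and> independent_set adj I} = {{}}"
    by (auto simp: independent_set_def)
  then show ?thesis by (simp add: partition_fun_def)
qed

lemma finite_indep: "finite S \<Longrightarrow> finite {I. I \<subseteq> S \<and> independent_set adj I}"
  by (rule finite_subset[of _ "Pow S"]) auto

lemma indep_sets_insert:
  assumes "simple_graph adj" "v \<notin> S"
  shows "{I. I \<subseteq> insert v S \<and> independent_set adj I \<and> v \<in> I}
           = insert v ` {I. I \<subseteq> S - nbrs adj v \<and> independent_set adj I}"
proof -
  have "I \<in> insert v ` {I. I \<subseteq> S - nbrs adj v \<and> independent_set adj I}"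
    if "I \<subseteq> insert v S" "independent_set adj I" "v \<in> I" for I
    using that by (intro image_eqI[of _ _ "I - {v}"]) (auto simp: independent_set_def)
  moreover have "independent_set adj (insert v I)"
    if "I \<subseteq> S - nbrs adj v" "independent_set adj I" for I
    using that assms by (auto simp: independent_set_def simple_graph_def)
  ultimately show ?thesis by auto
qed

lemma sum_indep_insert:
  fixes z :: "'b :: comm_semiring_1"
  assumes "simple_graph adj" "finite S" "v \<notin> S"
  shows "(\<Sum>I\<in>{I. I \<subseteq> insert v S \<and> independent_set adj I \<and> v \<in> I}. z ^ card I)
           = z * (\<Sum>I\<in>{I. I \<subseteq> S - nbrs adj v \<and> independent_set adj I}. z ^ card I)"
proof -
  let ?A = "{I. I \<subseteq> S - nbrs adj v \<and> independent_set adj I}"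
  have inj: "inj_on (insert v) ?A"
  proof (rule inj_onI)
    fix I J assume "I \<in> ?A" "J \<in> ?A" and eq: "insert v I = insert v J"
    then have "v \<notin> I" "v \<notin> J" using assms(3) by auto
    with eq show "I = J" by (simp add: insert_ident)
  qed
  have "card (insert v I) = Suc (card I)" if "I \<in> ?A" for I
    using that assms finite_subset[of I S] by (subst card_insert_disjoint) auto
  then show ?thesis
    unfolding indep_sets_insert[OF assms(1,3)] sum.reindex[OF inj] sum_distrib_left
    by (intro sum.cong) auto
qed

lemma partition_fun_insert:
  assumes "simple_graph adj" "finite S" "v \<notin> S"
  shows "partition_fun adj (insert v S) z
           = partition_fun adj S z + z * partition_fun adj (S - nbrs adj v) z"
proof -
  have "{I. I \<subseteq> insert v S \<and> independent_set adj I} =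
      {I. I \<subseteq> S \<and> independent_set adj I} \<union> {I. I \<subseteq> insert v S \<and> independent_set adj I \<and> v \<in> I}"
    by auto
  moreover have "{I. I \<subseteq> S \<and> independent_set adj I} \<inter>
      {I. I \<subseteq> insert v S \<and> independent_set adj I \<and> v \<in> I} = {}"
    using assms(3) by auto
  moreover have "finite {I. I \<subseteq> insert v S \<and> independent_set adj I \<and> v \<in> I}"
    using assms(2) by (intro finite_subset[OF _ finite_indep[of "insert v S" adj]]) auto
  ultimately show ?thesis
    unfolding partition_fun_def
    using sum_indep_insert[OF assms, of z] finite_indep[OF assms(2), of adj]
    by (simp add: sum.union_disjoint)
qed

lemma partition_fun_insert_ratio:
  assumes "simple_graph adj" "finite S" "v \<notin> S" "partition_fun adj S z \<noteq> 0"
  shows "partition_fun adj (insert v S) z = partition_fun adj S z * (1 + hc_ratio adj S v z)"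
  using assms by (simp add: partition_fun_insert hc_ratio_def field_simps)

text \<open>The quotient telescopes along the prefixes of \<open>us\<close>. Each link is the
  insertion formula read backwards, so a factor refers to the set left after its own
  deletion.\<close>

lemma partition_fun_remove_list:
  assumes "simple_graph adj" "finite S" "distinct us" "set us \<subseteq> S"
    and nz: "\<And>A. A \<subseteq> S \<Longrightarrow> partition_fun adj A z \<noteq> 0"
  shows "partition_fun adj (S - set us) z / partition_fun adj S z
           = (\<Prod>i<length us. inverse (1 + hc_ratio adj (S - set (take (Suc i) us)) (us ! i) z))"
proof -
  have "partition_fun adj (S - set (take j us)) z / partition_fun adj S z
           = (\<Prod>i<j. inverse (1 + hc_ratio adj (S - set (take (Suc i) us)) (us ! i) z))"
    if "j \<le> length us" for j
    using that
  proof (induction j)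
    case 0
    then show ?case using nz by simp
  next
    case (Suc j)
    let ?A = "S - set (take (Suc j) us)"
    have j: "j < length us" using Suc by simp
    have tk: "set (take (Suc j) us) = insert (us ! j) (set (take j us))"
      using j by (simp add: take_Suc_conv_app_nth)
    have "us ! j \<notin> set (take j us)"
      using j assms(3) by (auto simp: in_set_conv_nth nth_eq_iff_index_eq)
    then have A: "S - set (take j us) = insert (us ! j) ?A" "us ! j \<notin> ?A"
      using tk j assms(4) by auto
    have e1: "partition_fun adj (insert (us ! j) ?A) z = partition_fun adj ?A z * (1 + hc_ratio adj ?A (us ! j) z)"
      using assms A nz[of ?A] by (intro partition_fun_insert_ratio) auto
    have e2: "partition_fun adj (insert (us ! j) ?A) z \<noteq> 0"
      unfolding A(1)[symmetric] by (rule nz) auto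
    have "partition_fun adj ?A z
        = partition_fun adj (S - set (take j us)) z * inverse (1 + hc_ratio adj ?A (us ! j) z)"
    proof -
      have inv: "b = a * inverse c" if "a = b * c" "a \<noteq> 0" for a b c :: complex
        using that by auto
      show ?thesis unfolding A(1) by (rule inv[OF e1 e2])
    qed
    then have "partition_fun adj ?A z / partition_fun adj S z
        = partition_fun adj (S - set (take j us)) z / partition_fun adj S z
            * inverse (1 + hc_ratio adj ?A (us ! j) z)"
      by simp
    also have "partition_fun adj (S - set (take j us)) z / partition_fun adj S z
        = (\<Prod>i<j. inverse (1 + hc_ratio adj (S - set (take (Suc i) us)) (us ! i) z))"
      using Suc by simp
    finally show ?case by (simp only: prod.lessThan_Suc)
  qed
  from this[of "length us"] show ?thesis by simp
qed

lemma hc_ratio_recursion: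
  assumes "simple_graph adj" "finite S" "distinct us" "set us = nbrs adj v \<inter> S"
    and nz: "\<And>A. A \<subseteq> S \<Longrightarrow> partition_fun adj A z \<noteq> 0"
  shows "hc_ratio adj S v z
           = z * (\<Prod>i<length us. inverse (1 + hc_ratio adj (S - set (take (Suc i) us)) (us ! i) z))"
proof -
  have "S - nbrs adj v = S - set us" using assms(4) by auto
  then have "hc_ratio adj S v z = z * (partition_fun adj (S - set us) z / partition_fun adj S z)"
    by (simp add: hc_ratio_def)
  also have "\<dots> = z * (\<Prod>i<length us. inverse (1 + hc_ratio adj (S - set (take (Suc i) us)) (us ! i) z))"
    by (subst partition_fun_remove_list[OF assms(1-3) _ nz]) (use assms(4) in auto)
  finally show ?thesis .
qed

section \<open>Real activities\<close>

definition partition_real :: "('a \<Rightarrow> 'a \<Rightarrow> bool) \<Rightarrow> 'a set \<Rightarrow> real \<Rightarrow> real" where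
  "partition_real adj S l = (\<Sum>I\<in>{I. I \<subseteq> S \<and> independent_set adj I}. l ^ card I)"

lemma partition_fun_of_real: "partition_fun adj S (of_real l) = of_real (partition_real adj S l)"
  by (simp add: partition_fun_def partition_real_def)

lemma partition_real_ge_1:
  fixes S :: "'a set"
  assumes "finite S" "l \<ge> 0"
  shows "partition_real adj S l \<ge> 1"
proof -
  have "(\<Sum>I\<in>{{} :: 'a set}. l ^ card I) \<le> partition_real adj S l"
    unfolding partition_real_def using assms
    by (intro sum_mono2 finite_indep) (auto simp: independent_set_def)
  then show ?thesis by simp
qed

lemma partition_fun_real_nonzero:
  assumes "finite S" "l \<ge> 0"
  shows "partition_fun adj S (of_real l) \<noteq> 0"
  using partition_real_ge_1[OF assms, of adj] by (simp add: partition_fun_of_real)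

lemma hc_ratio_of_real:
  assumes "finite S" "l \<ge> 0"
  obtains x where "hc_ratio adj S v (of_real l) = of_real x" "0 \<le> x" "x \<le> l"
proof
  let ?x = "l * partition_real adj (S - nbrs adj v) l / partition_real adj S l"
  show "hc_ratio adj S v (of_real l) = of_real ?x"
    by (simp add: hc_ratio_def partition_fun_of_real)
  have 1: "partition_real adj S l \<ge> 1" "partition_real adj (S - nbrs adj v) l \<ge> 1"
    using assms by (auto intro: partition_real_ge_1)
  then show "0 \<le> ?x" using assms by simp
  have "partition_real adj (S - nbrs adj v) l \<le> partition_real adj S l"
    unfolding partition_real_def using assms by (intro sum_mono2 finite_indep) auto
  then have "l * partition_real adj (S - nbrs adj v) l \<le> l * partition_real adj S l"
    using assms by (intro mult_left_mono)
  then show "?x \<le> l" using 1 by (simp add: field_simps)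
qed

section \<open>Self-avoiding walks confined to a set\<close>

text \<open>The start is exempt from the confinement, because ratios are taken at vertices outside
  \<open>S\<close>.\<close>

definition saw_in :: "('a \<Rightarrow> 'a \<Rightarrow> bool) \<Rightarrow> 'a set \<Rightarrow> nat \<Rightarrow> 'a \<Rightarrow> 'a list set" where
  "saw_in adj S k v = {p \<in> saw adj k v. set (tl p) \<subseteq> S}"

lemma saw_0: "saw adj 0 v = {[v]}"
  by (auto simp: saw_def length_Suc_conv)

lemma saw_in_0 [simp]: "saw_in adj S 0 v = {[v]}"
  by (auto simp: saw_in_def saw_0)

lemma saw_Suc_subset: "saw adj (Suc k) v \<subseteq> (\<Union>u\<in>nbrs adj v. (#) v ` saw adj k u)"
proof
  fix p assume p: "p \<in> saw adj (Suc k) v"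
  then obtain u q where pq: "p = v # u # q"
    by (auto simp: saw_def length_Suc_conv)
  have step: "adj (p ! i) (p ! Suc i)" if "i < Suc k" for i
    using p that by (auto simp: saw_def)
  have "adj v u" using step[of 0] pq by simp
  moreover have "u # q \<in> saw adj k u"
    using p pq step[of "Suc i" for i] by (auto simp: saw_def)
  ultimately show "p \<in> (\<Union>u\<in>nbrs adj v. (#) v ` saw adj k u)" using pq by auto
qed

lemma finite_saw_num_saw_le:
  assumes deg: "\<And>v. finite (nbrs adj v)" "\<And>v. card (nbrs adj v) \<le> m"
  shows "finite (saw adj k v) \<and> num_saw adj k v \<le> m ^ k"
proof (induction k arbitrary: v)
  case 0
  then show ?case by (simp add: num_saw_def saw_0)
next
  case (Suc k)
  have fin: "finite (\<Union>u\<in>nbrs adj v. (#) v ` saw adj k u)"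
    using Suc deg by auto
  have "card (saw adj (Suc k) v) \<le> card (\<Union>u\<in>nbrs adj v. (#) v ` saw adj k u)"
    by (intro card_mono fin saw_Suc_subset)
  also have "\<dots> \<le> (\<Sum>u\<in>nbrs adj v. card ((#) v ` saw adj k u))"
    by (intro card_UN_le deg)
  also have "\<dots> \<le> (\<Sum>u\<in>nbrs adj v. m ^ k)"
    using Suc by (intro sum_mono order_trans[OF card_image_le]) (auto simp: num_saw_def)
  also have "\<dots> \<le> m * m ^ k"
    using deg by simp
  finally show ?case
    using finite_subset[OF saw_Suc_subset fin] by (simp add: num_saw_def)
qed

lemma saw_in_finite: "finite (saw adj k v) \<Longrightarrow> finite (saw_in adj S k v)"
  by (simp add: saw_in_def)

lemma saw_in_Cons:
  assumes "p \<in> saw_in adj A k u" "adj v u" "v \<notin> S" "u \<in> S" "A \<subseteq> S"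
  shows "v # p \<in> saw_in adj S (Suc k) v"
proof -
  obtain q where p: "p = u # q"
    using assms(1) by (cases p) (auto simp: saw_in_def saw_def)
  have "set p \<subseteq> S" using assms p by (auto simp: saw_in_def)
  moreover have "adj ((v # p) ! i) (p ! i)" if "i < Suc k" for i
    using that assms(1,2) p by (cases i) (auto simp: saw_in_def saw_def)
  ultimately show ?thesis
    using assms by (auto simp: saw_in_def saw_def)
qed

text \<open>Prefixing \<open>v\<close> keeps a walk self-avoiding since \<open>v\<close> is outside
  \<open>S\<close>, and walks of different children differ in their second vertex. Hence the tree of
  the recursion has at most as many branches of each length as there are walks from
  \<open>v\<close>.\<close>

lemma sum_card_saw_in_le:
  assumes fin: "\<And>k v. finite (saw adj k v)"
    and us: "distinct us" "set us \<subseteq> nbrs adj v \<inter> S" and v: "v \<notin> S"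
  shows "(\<Sum>i<length us. card (saw_in adj (S - set (take (Suc i) us)) k (us ! i)))
           \<le> card (saw_in adj S (Suc k) v)"
proof -
  let ?A = "\<lambda>i. saw_in adj (S - set (take (Suc i) us)) k (us ! i)"
  have "(\<Sum>i<length us. card (?A i)) = card (SIGMA i:{..<length us}. ?A i)"
    using fin by (intro card_SigmaI[symmetric]) (auto intro: saw_in_finite)
  also have "\<dots> \<le> card (saw_in adj S (Suc k) v)"
  proof (rule card_inj_on_le[where f = "\<lambda>(i, p). v # p"])
    show "inj_on (\<lambda>(i, p). v # p) (SIGMA i:{..<length us}. ?A i)"
      using us(1) by (intro inj_onI) (auto simp: saw_in_def saw_def nth_eq_iff_index_eq)
    show "(\<lambda>(i, p). v # p) ` (SIGMA i:{..<length us}. ?A i) \<subseteq> saw_in adj S (Suc k) v"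
    proof clarify
      fix i p assume "i < length us" and p: "p \<in> ?A i"
      then have "us ! i \<in> nbrs adj v \<inter> S" using us(2) nth_mem by blast
      then show "v # p \<in> saw_in adj S (Suc k) v"
        using p v by (intro saw_in_Cons[OF p]) auto
    qed
    show "finite (saw_in adj S (Suc k) v)" using fin by (rule saw_in_finite)
  qed
  finally show ?thesis .
qed

section \<open>The zero-free neighbourhood\<close>

text \<open>Besides nonvanishing, the half-plane keeps \<open>1 + hc_ratio\<close> off the branch
  cut of \<open>Ln\<close>, and the two bounds together bound its logarithm uniformly in
  \<open>S\<close> and \<open>v\<close>, as a normal-family argument requires.\<close>

definition zero_free_at :: "('a \<Rightarrow> 'a \<Rightarrow> bool) \<Rightarrow> real \<Rightarrow> complex \<Rightarrow> bool" where
  "zero_free_at adj C z \<longleftrightarrow> (\<forall>S. finite S \<longrightarrow> partition_fun adj S z \<noteq> 0 \<and>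
     (\<forall>v. v \<notin> S \<longrightarrow> Re (1 + hc_ratio adj S v z) \<ge> 1 / 2 \<and> cmod (1 + hc_ratio adj S v z) \<le> C))"

lemma card_saw_in_le_num_saw:
  assumes "finite (saw adj k v)"
  shows "card (saw_in adj S k v) \<le> num_saw adj k v"
  unfolding num_saw_def by (rule card_mono[OF assms]) (auto simp: saw_in_def)

text \<open>
  The deviation of the complex ratio from the real one is controlled by the weighted number of
  self-avoiding walks from \<open>v\<close> into \<open>S\<close>: the children of \<open>v\<close> in the recursion explore
  disjoint families of such walks.
\<close>

lemma hc_ratio_deviation:
  fixes adj :: "'a \<Rightarrow> 'a \<Rightarrow> bool" and D l0 e \<eta> \<epsilon> \<beta> \<nu> B M :: real and z :: complex
  assumes G: "simple_graph adj"
    and deg: "\<And>v. finite (nbrs adj v)" "\<And>v. card (nbrs adj v) \<le> m"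
    and D: "D > 0" and l0: "0 < l0" "l0 \<le> lambda_c (D + 1)"
    and z: "cmod (z - of_real l0) \<le> l0 * \<eta>"
    and e: "e > 0" "0 \<le> \<eta>" "1 + \<eta> \<le> (1 + e) * (1 - real m * \<epsilon>)"
    and \<epsilon>: "0 \<le> \<epsilon>" "\<epsilon> \<le> 1 / 2"
    and \<beta>_def: "\<beta> = 1 - D * ln (1 + 1 / D) / 2"
    and \<nu>_def: "\<nu> = (1 + e) powr (2 / \<beta>) / (D + 1)"
    and B_def: "B = ((1 + 1 / e) * \<eta>) powr (1 / \<beta>)"
    and M: "\<And>n v. (\<Sum>k<n. \<nu> ^ k * real (num_saw adj k v)) \<le> M"
    and small: "(B * M) powr \<beta> \<le> \<epsilon>"
  defines "T \<equiv> \<lambda>n S v. B * (\<Sum>k<n. \<nu> ^ k * real (card (saw_in adj S k v)))"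
  shows "finite S \<Longrightarrow> card S < n \<Longrightarrow> partition_fun adj S z \<noteq> 0 \<and>
    (\<forall>v x. v \<notin> S \<longrightarrow> hc_ratio adj S v (of_real l0) = of_real x \<longrightarrow>
       cmod (hc_ratio adj S v z - of_real x) \<le> sqrt (x * (1 + x)) * T n S v powr \<beta>)"
proof (induction n arbitrary: S)
  case 0
  then show ?case by simp
next
  case (Suc n)
  have "ln (1 + 1 / D) < 1 / D" using D by (intro ln_add_one_self_less_self) auto
  then have \<beta>: "\<beta> > 0" using D by (auto simp: \<beta>_def field_simps)
  have \<nu>: "\<nu> \<ge> 0" using D by (simp add: \<nu>_def)
  have B: "B \<ge> 0" by (simp add: B_def)
  have fin_saw: "finite (saw adj k v)" for k v
    using finite_saw_num_saw_le[of adj m k v, OF deg] by blast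
  have T0: "T n A v \<ge> 0" for A v n
    unfolding T_def using \<nu> B by (intro mult_nonneg_nonneg sum_nonneg) auto
  have TM: "T n A v \<le> B * M" for A v n
  proof -
    have "(\<Sum>k<n. \<nu> ^ k * real (card (saw_in adj A k v))) \<le> (\<Sum>k<n. \<nu> ^ k * real (num_saw adj k v))"
      using \<nu> card_saw_in_le_num_saw[OF fin_saw] by (intro sum_mono mult_left_mono) auto
    also note M
    finally show ?thesis unfolding T_def using B by (rule mult_left_mono)
  qed
  have T\<epsilon>: "T n A v powr \<beta> \<le> \<epsilon>" for A v n
    using powr_mono2[OF _ T0 TM, of \<beta>] \<beta> small by (meson less_imp_le order_trans)
  \<comment> \<open>Nonvanishing has to be carried in the same induction, since the recursion
    divides by partition functions of subsets of \<open>S\<close>. For one vertex less, the ratio is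
    within \<open>(1 + x) / 2\<close> of some \<open>x \<ge> 0\<close>, so it is not
    \<open>- 1\<close>.\<close>
  have nz_S: "partition_fun adj S z \<noteq> 0"
  proof (cases "S = {}")
    case False
    then obtain u where u: "u \<in> S" by blast
    define S' where "S' = S - {u}"
    have S': "S = insert u S'" "u \<notin> S'" "finite S'" using u Suc.prems by (auto simp: S'_def)
    then have "card S' < n" using Suc.prems by simp
    note IH = Suc.IH[OF S'(3) this]
    obtain x where x: "hc_ratio adj S' u (of_real l0) = of_real x" "0 \<le> x"
      using hc_ratio_of_real[OF S'(3), of l0 adj u] l0 by auto
    have "cmod (hc_ratio adj S' u z - of_real x) \<le> sqrt (x * (1 + x)) * T n S' u powr \<beta>"
      using IH S'(2) x by blast
    also have "\<dots> \<le> (1 + x) * (1 / 2)"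
    proof (intro mult_mono)
      have "x * (1 + x) \<le> (1 + x)\<^sup>2" using x by (simp add: power2_eq_square algebra_simps)
      then show "sqrt (x * (1 + x)) \<le> 1 + x" using x by (intro real_le_lsqrt) auto
    qed (use x T\<epsilon>[of n S' u] \<epsilon> in auto)
    also have "\<dots> < 1 + x" using x by simp
    finally have *: "cmod (hc_ratio adj S' u z - of_real x) < 1 + x" .
    have "1 + hc_ratio adj S' u z \<noteq> 0"
    proof
      assume "1 + hc_ratio adj S' u z = 0"
      then have "hc_ratio adj S' u z = - 1" by (simp add: add_eq_0_iff)
      then have "hc_ratio adj S' u z - of_real x = - of_real (1 + x)" by simp
      then have "cmod (hc_ratio adj S' u z - of_real x) = 1 + x"
        using x by (simp only: norm_minus_cancel norm_of_real)
      with * show False by simp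
    qed
    then show ?thesis
      using IH partition_fun_insert_ratio[OF G S'(3,2)] by (simp add: S'(1))
  qed simp
  have nz: "partition_fun adj A z \<noteq> 0" if "A \<subseteq> S" for A
  proof (cases "A = S")
    case False
    with that have "card A < card S" using Suc.prems by (intro psubset_card_mono) auto
    then show ?thesis using Suc.IH[of A] Suc.prems that finite_subset by auto
  qed (use nz_S in auto)
  have "cmod (hc_ratio adj S v z - of_real x) \<le> sqrt (x * (1 + x)) * T (Suc n) S v powr \<beta>"
    if v: "v \<notin> S" and x: "hc_ratio adj S v (of_real l0) = of_real x" for v x
  proof -
    obtain us where us: "distinct us" "set us = nbrs adj v \<inter> S"
      using finite_distinct_list[of "nbrs adj v \<inter> S"] deg by auto
    define A where "A = (\<lambda>i. S - set (take (Suc i) us))"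
    define I where "I = {..<length us}"
    have finA: "finite (A i)" for i using Suc.prems by (simp add: A_def)
    have cardA: "card (A i) < n" "us ! i \<notin> A i" if "i \<in> I" for i
    proof -
      have "us ! i \<in> set (take (Suc i) us)" using that by (simp add: I_def take_Suc_conv_app_nth)
      moreover have "us ! i \<in> S" using that us nth_mem[of i us] by (auto simp: I_def)
      ultimately have "A i \<subset> S" by (auto simp: A_def)
      then have "card (A i) < card S" using Suc.prems by (intro psubset_card_mono) auto
      then show "card (A i) < n" using Suc.prems by simp
      show "us ! i \<notin> A i" using \<open>us ! i \<in> set (take (Suc i) us)\<close> by (simp add: A_def)
    qed
    have "\<exists>x. hc_ratio adj (A i) (us ! i) (of_real l0) = of_real x \<and> 0 \<le> x" for i
      using hc_ratio_of_real[OF finA, of l0 adj i "us ! i"] l0 by (metis less_imp_le)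
    then obtain xs where xs: "\<And>i. hc_ratio adj (A i) (us ! i) (of_real l0) = of_real (xs i)"
      "\<And>i. 0 \<le> xs i" by metis
    have l0nz: "partition_fun adj A (of_real l0) \<noteq> 0" if "A \<subseteq> S" for A
      using that Suc.prems l0 finite_subset by (intro partition_fun_real_nonzero) auto
    have rec: "hc_ratio adj S v w = w * (\<Prod>i\<in>I. inverse (1 + hc_ratio adj (A i) (us ! i) w))"
      if "\<And>A. A \<subseteq> S \<Longrightarrow> partition_fun adj A w \<noteq> 0" for w
      unfolding A_def I_def by (rule hc_ratio_recursion[OF G Suc.prems(1) us that])
    have "complex_of_real x = of_real (l0 * (\<Prod>i\<in>I. inverse (1 + xs i)))"
      using rec[OF l0nz] x xs by simp
    then have xf: "x = l0 * (\<Prod>i\<in>I. inverse (1 + xs i))" by (simp only: of_real_eq_iff)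
    have zg: "hc_ratio adj S v z = z * (\<Prod>i\<in>I. inverse (1 + hc_ratio adj (A i) (us ! i) z))"
      by (rule rec[OF nz])
    have cardI: "card I \<le> m"
    proof -
      have "card I = card (nbrs adj v \<inter> S)" using us by (metis I_def card_lessThan distinct_card)
      also have "\<dots> \<le> card (nbrs adj v)" using deg by (intro card_mono) auto
      finally show ?thesis using deg(2)[of v] by simp
    qed
    have "cmod (hc_ratio adj S v z - of_real x)
      \<le> sqrt (x * (1 + x)) * ((1 + e) * ((D + 1) powr (- \<beta>) * (\<Sum>i\<in>I. T n (A i) (us ! i)) powr \<beta>) + \<eta>)"
    proof (rule complex_recursion_step[where T = "\<lambda>i. T n (A i) (us ! i)", OF _ cardI D l0 xs(2) T0 _ T\<epsilon> z e \<epsilon>(1) \<beta>_def xf zg])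
      fix i assume i: "i \<in> I"
      show "cmod (hc_ratio adj (A i) (us ! i) z - of_real (xs i))
         \<le> sqrt (xs i * (1 + xs i)) * T n (A i) (us ! i) powr \<beta>"
        using Suc.IH[OF finA cardA(1)[OF i]] xs(1)[of i] cardA(2)[OF i] by blast
    qed (simp add: I_def)
    also have "\<dots> \<le> sqrt (x * (1 + x)) * T (Suc n) S v powr \<beta>"
    proof (rule mult_left_mono)
      define X where "X = (\<Sum>i\<in>I. T n (A i) (us ! i))"
      have X0: "X \<ge> 0" unfolding X_def by (intro sum_nonneg T0)
      have "(1 + e) * ((D + 1) powr (- \<beta>) * X powr \<beta>) + \<eta> \<le> (\<nu> * X + B) powr \<beta>"
        unfolding \<nu>_def B_def using X0 \<beta> e D by (intro absorb_error_powr) auto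
      also have "\<dots> \<le> T (Suc n) S v powr \<beta>"
      proof (rule powr_mono2)
        have "X = (\<Sum>k<n. \<Sum>i\<in>I. B * (\<nu> ^ k * real (card (saw_in adj (A i) k (us ! i)))))"
          unfolding X_def T_def sum_distrib_left by (rule sum.swap)
        also have "\<dots> = (\<Sum>k<n. B * (\<nu> ^ k * real (\<Sum>i\<in>I. card (saw_in adj (A i) k (us ! i)))))"
          by (simp add: sum_distrib_left)
        also have "\<dots> \<le> (\<Sum>k<n. B * (\<nu> ^ k * real (card (saw_in adj S (Suc k) v))))"
          unfolding I_def A_def using B \<nu> us v sum_card_saw_in_le[of adj us v S, OF fin_saw]
          by (intro sum_mono mult_left_mono of_nat_mono) auto
        finally have "\<nu> * X \<le> \<nu> * (\<Sum>k<n. B * (\<nu> ^ k * real (card (saw_in adj S (Suc k) v))))"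
          using \<nu> by (rule mult_left_mono)
        \<comment> \<open>The walk of length 0 counts 1 and supplies the summand \<open>B\<close>;
          all longer walks lose their first step and pay a factor \<nu>.\<close>
        then show "\<nu> * X + B \<le> T (Suc n) S v"
          unfolding T_def sum.lessThan_Suc_shift by (simp add: sum_distrib_left algebra_simps)
      qed (use \<beta> \<nu> X0 B in auto)
      finally show "(1 + e) * ((D + 1) powr (- \<beta>) * (\<Sum>i\<in>I. T n (A i) (us ! i)) powr \<beta>) + \<eta>
          \<le> T (Suc n) S v powr \<beta>" by (simp add: X_def)
      obtain x' where "hc_ratio adj S v (of_real l0) = of_real x'" "0 \<le> x'"
        using hc_ratio_of_real[OF Suc.prems(1), of l0 adj v] l0 by auto
      with x have "x \<ge> 0" by simp
      then show "0 \<le> sqrt (x * (1 + x))" by simp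
    qed
    finally show ?thesis .
  qed
  with nz_S show ?case by blast
qed

text \<open>The deviation is at most \<open>(1 + x) / 2\<close>, so the real part of
  \<open>1 + hc_ratio\<close> keeps half of \<open>1 + x \<ge> 1\<close> and its modulus is at most
  \<open>3 / 2 * (1 + l0)\<close>.\<close>

lemma zero_free_at_near_real:
  fixes adj :: "'a \<Rightarrow> 'a \<Rightarrow> bool" and D l0 e \<eta> \<epsilon> \<beta> \<nu> B M :: real and z :: complex
  assumes G: "simple_graph adj"
    and deg: "\<And>v. finite (nbrs adj v)" "\<And>v. card (nbrs adj v) \<le> m"
    and D: "D > 0" and l0: "0 < l0" "l0 \<le> lambda_c (D + 1)"
    and z: "cmod (z - of_real l0) \<le> l0 * \<eta>"
    and e: "e > 0" "0 \<le> \<eta>" "1 + \<eta> \<le> (1 + e) * (1 - real m * \<epsilon>)"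
    and \<epsilon>: "0 \<le> \<epsilon>" "\<epsilon> \<le> 1 / 2"
    and \<beta>_def: "\<beta> = 1 - D * ln (1 + 1 / D) / 2"
    and \<nu>_def: "\<nu> = (1 + e) powr (2 / \<beta>) / (D + 1)"
    and B_def: "B = ((1 + 1 / e) * \<eta>) powr (1 / \<beta>)"
    and M: "\<And>n v. (\<Sum>k<n. \<nu> ^ k * real (num_saw adj k v)) \<le> M"
    and small: "(B * M) powr \<beta> \<le> \<epsilon>"
  shows "zero_free_at adj (2 * (1 + l0)) z"
  unfolding zero_free_at_def
proof (intro allI impI)
  fix S :: "'a set" assume S: "finite S"
  note dev = hc_ratio_deviation[OF G deg D l0 z e \<epsilon> \<beta>_def \<nu>_def B_def M small S lessI]
  have "ln (1 + 1 / D) < 1 / D" using D by (intro ln_add_one_self_less_self) auto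
  then have \<beta>: "\<beta> > 0" using D by (auto simp: \<beta>_def field_simps)
  have \<nu>: "\<nu> \<ge> 0" using D by (simp add: \<nu>_def)
  have B: "B \<ge> 0" by (simp add: B_def)
  have fin_saw: "finite (saw adj k v)" for k v
    using finite_saw_num_saw_le[of adj m k v, OF deg] by blast
  show "partition_fun adj S z \<noteq> 0 \<and> (\<forall>v. v \<notin> S \<longrightarrow> Re (1 + hc_ratio adj S v z) \<ge> 1 / 2
      \<and> cmod (1 + hc_ratio adj S v z) \<le> 2 * (1 + l0))"
  proof (intro conjI allI impI)
    show "partition_fun adj S z \<noteq> 0" using dev by blast
    fix v assume v: "v \<notin> S"
    define h where "h = hc_ratio adj S v z"
    obtain x where x: "hc_ratio adj S v (of_real l0) = of_real x" "0 \<le> x" "x \<le> l0"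
      using hc_ratio_of_real[OF S, of l0 adj v] l0 by auto
    let ?T = "B * (\<Sum>k<Suc (card S). \<nu> ^ k * real (card (saw_in adj S k v)))"
    have "cmod (h - of_real x) \<le> sqrt (x * (1 + x)) * ?T powr \<beta>"
      using dev v x unfolding h_def by blast
    also have "\<dots> \<le> (1 + x) * (1 / 2)"
    proof (intro mult_mono)
      have "x * (1 + x) \<le> (1 + x)\<^sup>2" using x by (simp add: power2_eq_square algebra_simps)
      then show "sqrt (x * (1 + x)) \<le> 1 + x" using x by (intro real_le_lsqrt) auto
      have "(\<Sum>k<Suc (card S). \<nu> ^ k * real (card (saw_in adj S k v)))
          \<le> (\<Sum>k<Suc (card S). \<nu> ^ k * real (num_saw adj k v))"
        using \<nu> card_saw_in_le_num_saw[OF fin_saw] by (intro sum_mono mult_left_mono) auto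
      also note M
      finally have "?T \<le> B * M" using B by (rule mult_left_mono)
      moreover have "?T \<ge> 0" using \<nu> B by (intro mult_nonneg_nonneg sum_nonneg) auto
      ultimately have "?T powr \<beta> \<le> (B * M) powr \<beta>" using \<beta> by (intro powr_mono2) auto
      then show "?T powr \<beta> \<le> 1 / 2" using small \<epsilon> by simp
    qed (use x in auto)
    finally have h: "cmod (h - of_real x) \<le> (1 + x) / 2" by simp
    have "\<bar>Re (h - of_real x)\<bar> \<le> (1 + x) / 2" using h abs_Re_le_cmod order_trans by blast
    then show "1 / 2 \<le> Re (1 + hc_ratio adj S v z)"
      using x unfolding h_def[symmetric] by (simp add: abs_if split: if_splits)
    have "cmod (1 + h) \<le> cmod (of_real (1 + x)) + cmod (h - of_real x)"
      using norm_triangle_ineq[of "of_real (1 + x)" "h - of_real x"] by simp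
    also have "\<dots> \<le> (1 + x) + (1 + x) / 2"
      using h x by (simp only: norm_of_real)
    finally show "cmod (1 + hc_ratio adj S v z) \<le> 2 * (1 + l0)"
      using x(2,3) unfolding h_def[symmetric] by (simp add: field_simps)
  qed
qed

section \<open>Activities near zero\<close>

text \<open>If smaller sets have ratios at most 1/2, each of the at most \<open>m\<close> factors of
  the recursion is at most 2 and the ratio is at most \<open>cmod z * 2 ^ m\<close>. This covers the
  origin, where an error proportional to the real activity leaves no room.\<close>

lemma hc_ratio_small_disc:
  fixes adj :: "'a \<Rightarrow> 'a \<Rightarrow> bool"
  assumes G: "simple_graph adj"
    and deg: "\<And>v. finite (nbrs adj v)" "\<And>v. card (nbrs adj v) \<le> m"
    and z: "cmod z \<le> 1 / 2 ^ Suc m"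
  shows "finite S \<Longrightarrow> partition_fun adj S z \<noteq> 0 \<and> (\<forall>v. v \<notin> S \<longrightarrow> cmod (hc_ratio adj S v z) \<le> 1 / 2)"
proof (induction "card S" arbitrary: S rule: less_induct)
  case less
  have nz_S: "partition_fun adj S z \<noteq> 0"
  proof (cases "S = {}")
    case False
    then obtain u where u: "u \<in> S" by blast
    define S' where "S' = S - {u}"
    have S': "S = insert u S'" "u \<notin> S'" "finite S'" using u less.prems by (auto simp: S'_def)
    then have "card S' < card S" by simp
    note IH = less.hyps[OF this S'(3)]
    then have "cmod (hc_ratio adj S' u z) \<le> 1 / 2" using S' by blast
    then have "1 + hc_ratio adj S' u z \<noteq> 0" by (auto simp: add_eq_0_iff)
    then show ?thesis
      using IH partition_fun_insert_ratio[OF G S'(3,2)] by (simp add: S'(1))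
  qed simp
  have nz: "partition_fun adj A z \<noteq> 0" if "A \<subseteq> S" for A
  proof (cases "A = S")
    case False
    with that have "card A < card S" using less.prems by (intro psubset_card_mono) auto
    then show ?thesis using less.hyps[of A] less.prems that finite_subset by auto
  qed (use nz_S in auto)
  have "cmod (hc_ratio adj S v z) \<le> 1 / 2" if v: "v \<notin> S" for v
  proof -
    obtain us where us: "distinct us" "set us = nbrs adj v \<inter> S"
      using finite_distinct_list[of "nbrs adj v \<inter> S"] deg by auto
    have len: "length us \<le> m"
    proof -
      have "length us = card (nbrs adj v \<inter> S)" using us by (metis distinct_card)
      also have "\<dots> \<le> card (nbrs adj v)" using deg by (intro card_mono) auto
      finally show ?thesis using deg(2)[of v] by simp
    qed
    have fac: "cmod (inverse (1 + hc_ratio adj (S - set (take (Suc i) us)) (us ! i) z)) \<le> 2"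
      if i: "i < length us" for i
    proof -
      define A where "A = S - set (take (Suc i) us)"
      have u: "us ! i \<in> set (take (Suc i) us)" using i by (simp add: take_Suc_conv_app_nth)
      moreover have "us ! i \<in> S" using i us nth_mem[of i us] by auto
      ultimately have "A \<subset> S" by (auto simp: A_def)
      then have "card A < card S" using less.prems by (intro psubset_card_mono) auto
      then have h: "cmod (hc_ratio adj A (us ! i) z) \<le> 1 / 2"
        using less.hyps[of A] less.prems u by (auto simp: A_def)
      have "cmod 1 - cmod (hc_ratio adj A (us ! i) z) \<le> cmod (1 + hc_ratio adj A (us ! i) z)"
        using norm_diff_ineq by blast
      with h have "1 / 2 \<le> cmod (1 + hc_ratio adj A (us ! i) z)" by simp
      then have "inverse (cmod (1 + hc_ratio adj A (us ! i) z)) \<le> inverse (1 / 2)"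
        by (intro le_imp_inverse_le) auto
      then show ?thesis by (simp add: norm_inverse A_def)
    qed
    have "cmod (hc_ratio adj S v z) = cmod z * (\<Prod>i<length us. cmod (inverse (1 + hc_ratio adj (S - set (take (Suc i) us)) (us ! i) z)))"
      by (subst hc_ratio_recursion[OF G less.prems us nz]) (simp_all only: norm_mult prod_norm)
    also have "\<dots> \<le> (1 / 2 ^ Suc m) * (\<Prod>i<length us. 2)"
      using z fac by (intro mult_mono prod_mono prod_nonneg) auto
    also have "\<dots> = 2 ^ length us / 2 ^ Suc m" by simp
    also have "\<dots> \<le> 2 ^ m / 2 ^ Suc m"
      using len by (intro divide_right_mono power_increasing) auto
    also have "\<dots> = 1 / 2" by simp
    finally show ?thesis .
  qed
  with nz_S show ?case by blast
qed

lemma zero_free_at_small: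
  fixes adj :: "'a \<Rightarrow> 'a \<Rightarrow> bool"
  assumes "simple_graph adj" "\<And>v. finite (nbrs adj v)" "\<And>v. card (nbrs adj v) \<le> m"
    and "cmod z \<le> 1 / 2 ^ Suc m" and C: "C \<ge> 3 / 2"
  shows "zero_free_at adj C z"
  unfolding zero_free_at_def
proof (intro allI impI conjI)
  fix S :: "'a set" and v assume S: "finite S"
  note * = hc_ratio_small_disc[OF assms(1-4) S]
  show "partition_fun adj S z \<noteq> 0" using * by blast
  assume "v \<notin> S"
  with * have h: "cmod (hc_ratio adj S v z) \<le> 1 / 2" by blast
  have "\<bar>Re (hc_ratio adj S v z)\<bar> \<le> 1 / 2" using h abs_Re_le_cmod order_trans by blast
  then show "1 / 2 \<le> Re (1 + hc_ratio adj S v z)" by (simp add: abs_if split: if_splits)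
  show "cmod (1 + hc_ratio adj S v z) \<le> C"
    using norm_triangle_ineq[of 1 "hc_ratio adj S v z"] h C by simp
qed

lemma zero_free_at_mono: "zero_free_at adj C z \<Longrightarrow> C \<le> C' \<Longrightarrow> zero_free_at adj C' z"
  unfolding zero_free_at_def by (meson order_trans)

lemma zero_free_neighbourhood:
  fixes adj :: "'a \<Rightarrow> 'a \<Rightarrow> bool" and D lam \<mu> C :: real
  assumes G: "simple_graph adj"
    and deg: "\<And>v. finite (nbrs adj v)" "\<And>v. card (nbrs adj v) \<le> m"
    and D: "D > 0" and lam: "0 \<le> lam" "lam \<le> lambda_c (D + 1)"
    and growth: "\<And>k v. real (num_saw adj k v) \<le> C * \<mu> ^ k" and C: "C > 0" and \<mu>: "0 < \<mu>" "\<mu> < D + 1"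
  shows "\<exists>\<delta>>0. \<forall>z\<in>Ldelta \<delta> (real_interval lam). zero_free_at adj (2 * (1 + lam)) z"
proof -
  define \<beta> where "\<beta> = 1 - D * ln (1 + 1 / D) / 2"
  have "ln (1 + 1 / D) < 1 / D" using D by (intro ln_add_one_self_less_self) auto
  then have \<beta>: "\<beta> > 0" using D by (auto simp: \<beta>_def field_simps)
  \<comment> \<open>The gap \<open>(D + 1) / \<mu>\<close> is split evenly: two factors
    \<open>1 + e\<close>, raised to \<open>1 / \<beta>\<close>, use up its square root
    \<open>r\<close>, and \<open>\<nu> * \<mu> = 1 / r < 1\<close> remains.\<close>
  define r where "r = sqrt ((D + 1) / \<mu>)"
  have r: "r > 1" "r * r = (D + 1) / \<mu>" using \<mu> D by (auto simp: r_def)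
  define e where "e = r powr (\<beta> / 2) - 1"
  have e: "e > 0" using r \<beta> by (simp add: e_def gr_one_powr)
  define \<nu> where "\<nu> = (1 + e) powr (2 / \<beta>) / (D + 1)"
  have "(1 + e) powr (2 / \<beta>) = r" using r \<beta> by (simp add: e_def powr_powr)
  then have \<nu>: "\<nu> = r / (D + 1)" by (simp add: \<nu>_def)
  have "r * (\<nu> * \<mu>) = 1" using r \<mu> D by (simp add: \<nu> mult.assoc[symmetric])
  then have "\<nu> * \<mu> = 1 / r" using r by (simp add: field_simps)
  then have \<nu>\<mu>: "0 < \<nu> * \<mu>" "\<nu> * \<mu> < 1" using r by auto
  have \<nu>0: "\<nu> > 0" using r D by (simp add: \<nu>)
  define M where "M = C / (1 - \<nu> * \<mu>)"
  have M0: "M > 0" using C \<nu>\<mu> by (simp add: M_def)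
  have M: "(\<Sum>k<n. \<nu> ^ k * real (num_saw adj k v)) \<le> M" for n v
  proof -
    have "(\<Sum>k<n. \<nu> ^ k * real (num_saw adj k v)) \<le> (\<Sum>k<n. \<nu> ^ k * (C * \<mu> ^ k))"
      using \<nu>0 growth by (intro sum_mono mult_left_mono) auto
    also have "\<dots> = C * (\<Sum>k<n. (\<nu> * \<mu>) ^ k)"
      by (simp add: sum_distrib_left power_mult_distrib mult_ac)
    also have "(\<Sum>k<n. (\<nu> * \<mu>) ^ k) \<le> 1 / (1 - \<nu> * \<mu>)"
      using \<nu>\<mu> by (simp add: sum_gp_strict divide_right_mono)
    finally show ?thesis using C by (simp add: M_def mult_left_mono)
  qed
  \<comment> \<open>The second entry makes \<open>m\<close> children cost at most half of
    \<open>e\<close>; the cap 1/2 keeps \<open>1 + hc_ratio\<close> away from 0.\<close>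
  define \<epsilon> where "\<epsilon> = min (1 / 2) (e / (2 * (1 + e) * (real m + 1)))"
  have \<epsilon>: "0 < \<epsilon>" "\<epsilon> \<le> 1 / 2"
    unfolding \<epsilon>_def using e by (simp_all only: min.cobounded1) simp
  have m\<epsilon>: "1 + e / 2 \<le> (1 + e) * (1 - real m * \<epsilon>)"
  proof -
    have "(1 + e) * (real m * \<epsilon>) \<le> (1 + e) * ((real m + 1) * (e / (2 * (1 + e) * (real m + 1))))"
      using e \<epsilon> by (intro mult_left_mono mult_mono) (auto simp: \<epsilon>_def)
    also have "\<dots> = e / 2"
    proof -
      have cancel: "a * (b * (c / (2 * a * b))) = c / 2" if "a > 0" "b > 0" for a b c :: real
        using that by simp
      show ?thesis by (rule cancel) (use e in auto)
    qed
    finally show ?thesis by (simp add: algebra_simps)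
  qed
  \<comment> \<open>The other half of \<open>e\<close> pays for the change of activity, and the
    second entry is the largest error for which \<open>(B * M) powr \<beta>\<close> stays below
    \<epsilon>.\<close>
  define \<eta> where "\<eta> = min (e / 2) (\<epsilon> / ((1 + 1 / e) * M powr \<beta>))"
  have Mp: "(1 + 1 / e) * M powr \<beta> > 0" using e M0 by (simp add: add_pos_pos)
  have \<eta>: "\<eta> > 0" "\<eta> \<le> e / 2" unfolding \<eta>_def using e \<epsilon> Mp by (simp_all only: min.cobounded1) simp
  define B where "B = ((1 + 1 / e) * \<eta>) powr (1 / \<beta>)"
  have small: "(B * M) powr \<beta> \<le> \<epsilon>"
  proof -
    have "(B * M) powr \<beta> = (1 + 1 / e) * \<eta> * M powr \<beta>"
      unfolding powr_mult B_def using e \<eta> \<beta> by (simp add: powr_powr)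
    also have "\<dots> = \<eta> * ((1 + 1 / e) * M powr \<beta>)" by (simp add: mult_ac)
    also have "\<dots> \<le> \<epsilon> / ((1 + 1 / e) * M powr \<beta>) * ((1 + 1 / e) * M powr \<beta>)"
      using Mp by (intro mult_right_mono) (auto simp: \<eta>_def)
    also have "\<dots> = \<epsilon>" using Mp by (metis less_irrefl nonzero_eq_divide_eq)
    finally show ?thesis .
  qed
  define r0 :: real where "r0 = 1 / 2 ^ Suc m"
  have r0: "r0 > 0" by (simp add: r0_def)
  \<comment> \<open>For \<open>l \<le> r0 / 2\<close> the first entry keeps \<open>z\<close> in the
    disc of radius \<open>r0\<close>; for larger \<open>l\<close> the second entry is at most
    \<open>l * \<eta>\<close>.\<close>
  define \<delta> where "\<delta> = min (r0 / 2) (r0 / 2 * \<eta>)"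
  have "zero_free_at adj (2 * (1 + lam)) z" if "z \<in> Ldelta \<delta> (real_interval lam)" for z
  proof -
    obtain l where l: "0 \<le> l" "l \<le> lam" "cmod (z - of_real l) \<le> \<delta>"
      using \<open>z \<in> _\<close> by (auto simp: Ldelta_def real_interval_def)
    show ?thesis
    proof (cases "l \<le> r0 / 2")
      case True
      have "cmod z \<le> cmod (z - of_real l) + cmod (of_real l)"
        by (metis diff_add_cancel norm_triangle_ineq)
      also have "\<dots> \<le> r0" using True l by (simp add: \<delta>_def)
      finally show ?thesis
        using lam by (intro zero_free_at_small[OF G deg]) (auto simp: r0_def)
    next
      case False
      then have "l > 0" using r0 by simp
      moreover have "cmod (z - of_real l) \<le> l * \<eta>"
      proof -
        have "r0 / 2 * \<eta> \<le> l * \<eta>" using False \<eta> by (intro mult_right_mono) auto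
        then show ?thesis using l by (simp add: \<delta>_def)
      qed
      ultimately have "zero_free_at adj (2 * (1 + l)) z"
        using l lam \<eta> m\<epsilon> \<epsilon>
        by (intro zero_free_at_near_real[OF G deg D _ _ _ e _ _ _ _ \<beta>_def \<nu>_def B_def M small]) auto
      then show ?thesis using l by (elim zero_free_at_mono) simp
    qed
  qed
  moreover have "\<delta> > 0" using r0 \<eta> by (simp add: \<delta>_def)
  ultimately show ?thesis by blast
qed

section \<open>Branches of the logarithm and convergence\<close>

text \<open>Two logarithms of one function differ by multiples of 2 pi i, so their continuous
  difference has a range with gaps of at least 2 pi and is constant on a connected set.\<close>

lemma continuous_log_unique:
  fixes g h :: "complex \<Rightarrow> complex"
  assumes "connected D" "continuous_on D g" "continuous_on D h"
    and eq: "\<And>z. z \<in> D \<Longrightarrow> exp (g z) = exp (h z)"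
    and w: "w \<in> D" "g w = h w" and z: "z \<in> D"
  shows "g z = h z"
proof -
  have "(\<lambda>z. g z - h z) constant_on D"
  proof (rule continuous_discrete_range_constant[OF assms(1)])
    show "continuous_on D (\<lambda>z. g z - h z)" using assms by (intro continuous_intros)
    fix x assume x: "x \<in> D"
    have "2 * pi \<le> cmod (g y - h y - (g x - h x))" if y: "y \<in> D" "g y - h y \<noteq> g x - h x" for y
    proof (rule ccontr)
      assume "\<not> ?thesis"
      then have "\<bar>Im (g y - h y - (g x - h x))\<bar> < 2 * pi"
        using abs_Im_le_cmod le_less_trans not_le by blast
      then have 1: "\<bar>Im (g y - h y) - Im (g x - h x)\<bar> < 2 * pi"
        by (simp only: minus_complex.sel)
      have 2: "exp (g y - h y) = exp (g x - h x)"
        unfolding exp_diff eq[OF x] eq[OF y(1)] by simp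
      have "g y - h y = g x - h x" by (rule exp_complex_eqI[OF 1 2])
      with y show False by simp
    qed
    then show "\<exists>e>0. \<forall>y. y \<in> D \<and> g y - h y \<noteq> g x - h x \<longrightarrow> e \<le> cmod (g y - h y - (g x - h x))"
      by (intro exI[of _ "2 * pi"]) auto
  qed
  then obtain c where "\<And>z. z \<in> D \<Longrightarrow> g z - h z = c" by (auto simp: constant_on_def)
  from this[OF w(1)] this[OF z] w(2) show ?thesis by simp
qed

lemma cmod_Ln_le:
  assumes "Re w \<ge> 1 / 2" "cmod w \<le> C"
  shows "cmod (Ln w) \<le> ln 2 + \<bar>ln C\<bar> + pi"
proof -
  have c: "cmod w \<ge> 1 / 2" using assms(1) complex_Re_le_cmod order_trans by blast
  then have w: "w \<noteq> 0" by auto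
  have "ln (1 / 2) \<le> ln (cmod w)" using c by (subst ln_le_cancel_iff) auto
  then have "- ln 2 \<le> ln (cmod w)" by (simp add: ln_div)
  moreover have "ln (cmod w) \<le> ln C"
    using assms(2) c by (subst ln_le_cancel_iff) auto
  moreover have "ln (2 :: real) > 0" by simp
  ultimately have "\<bar>Re (Ln w)\<bar> \<le> ln 2 + \<bar>ln C\<bar>"
    unfolding Re_Ln[OF w] by linarith
  moreover have "\<bar>Im (Ln w)\<bar> \<le> pi"
    using mpi_less_Im_Ln[OF w] Im_Ln_le_pi[OF w] by auto
  ultimately show ?thesis using cmod_le[of "Ln w"] by simp
qed

lemma partition_fun_holomorphic [holomorphic_intros]: "partition_fun adj S holomorphic_on A"
  unfolding partition_fun_def by (intro holomorphic_intros)

lemma partition_fun_0 [simp]: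
  assumes "finite S"
  shows "partition_fun adj S 0 = 1"
proof -
  have "partition_fun adj S (of_real 0) = (\<Sum>I\<in>{I. I \<subseteq> S \<and> independent_set adj I}. if I = {} then 1 else 0)"
    unfolding partition_fun_def
    using finite_subset[OF _ assms] by (intro sum.cong refl) (auto simp: power_0_left card_eq_0_iff)
  also have "\<dots> = 1"
    using finite_indep[OF assms, of adj] by (simp add: independent_set_def)
  finally show ?thesis by simp
qed

text \<open>The argument of \<open>Z\<close> may grow with the volume, so the principal logarithm of
  \<open>Z\<close> is no candidate for a branch. Adding one vertex multiplies \<open>Z\<close> by a
  number in the right half-plane, and the sum of the principal logarithms of these factors is a
  branch with a bound linear in \<open>card \<Lambda>\<close>.\<close>

lemma partition_fun_Ln_sum:
  fixes adj :: "'a \<Rightarrow> 'a \<Rightarrow> bool"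
  assumes G: "simple_graph adj" and zf: "\<And>z. z \<in> D \<Longrightarrow> zero_free_at adj C z"
    and \<Lambda>: "finite \<Lambda>"
  obtains h where "h holomorphic_on D" "h 0 = 0"
    "\<And>z. z \<in> D \<Longrightarrow> exp (h z) = partition_fun adj \<Lambda> z"
    "\<And>z. z \<in> D \<Longrightarrow> cmod (h z) \<le> real (card \<Lambda>) * (ln 2 + \<bar>ln C\<bar> + pi)"
proof -
  have "\<exists>h. h holomorphic_on D \<and> h 0 = 0 \<and> (\<forall>z\<in>D. exp (h z) = partition_fun adj \<Lambda> z \<and>
     cmod (h z) \<le> real (card \<Lambda>) * (ln 2 + \<bar>ln C\<bar> + pi))"
    using \<Lambda>
  proof (induction \<Lambda>)
    case empty
    show ?case by (intro exI[of _ "\<lambda>_. 0"]) auto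
  next
    case (insert v S)
    then obtain h where h: "h holomorphic_on D" "h 0 = 0"
      "\<And>z. z \<in> D \<Longrightarrow> exp (h z) = partition_fun adj S z"
      "\<And>z. z \<in> D \<Longrightarrow> cmod (h z) \<le> real (card S) * (ln 2 + \<bar>ln C\<bar> + pi)" by blast
    have nz: "partition_fun adj S z \<noteq> 0" "Re (1 + hc_ratio adj S v z) \<ge> 1 / 2"
      "cmod (1 + hc_ratio adj S v z) \<le> C" if "z \<in> D" for z
      using zf[OF that] insert unfolding zero_free_at_def by auto
    have nn: "1 + hc_ratio adj S v z \<notin> \<real>\<^sub>\<le>\<^sub>0" "1 + hc_ratio adj S v z \<noteq> 0" if "z \<in> D" for z
      using nz(2)[OF that] by (auto simp: complex_nonpos_Reals_iff complex_eq_iff)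
    let ?h = "\<lambda>z. h z + Ln (1 + hc_ratio adj S v z)"
    have "?h holomorphic_on D"
      using h(1) nz(1) nn unfolding hc_ratio_def by (intro holomorphic_intros) auto
    moreover have "?h 0 = 0" using h(2) by (simp add: hc_ratio_def)
    moreover have "exp (?h z) = partition_fun adj (insert v S) z" if "z \<in> D" for z
      using h(3) nz nn that insert partition_fun_insert_ratio[OF G, of S v z] by (simp add: exp_add)
    moreover have "cmod (?h z) \<le> real (card (insert v S)) * (ln 2 + \<bar>ln C\<bar> + pi)" if "z \<in> D" for z
      using norm_triangle_ineq[of "h z" "Ln (1 + hc_ratio adj S v z)"] h(4)[OF that]
        cmod_Ln_le[OF nz(2,3)[OF that]] insert by (simp add: algebra_simps)
    ultimately show ?case by blast
  qed
  then show ?thesis using that by blast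
qed

text \<open>The branches in the free energy are merely continuous; identifying them with the
  explicit sum supplies holomorphy and the bound.\<close>

lemma log_partition_fun_branch:
  fixes adj :: "'a \<Rightarrow> 'a \<Rightarrow> bool"
  assumes G: "simple_graph adj" and zf: "\<And>z. z \<in> D \<Longrightarrow> zero_free_at adj C z"
    and \<Lambda>: "finite \<Lambda>" and D: "connected D" "0 \<in> D"
    and g: "continuous_on D g" "g 0 = 0" "\<And>z. z \<in> D \<Longrightarrow> exp (g z) = partition_fun adj \<Lambda> z"
  shows "g holomorphic_on D"
    and "\<And>z. z \<in> D \<Longrightarrow> cmod (g z) \<le> real (card \<Lambda>) * (ln 2 + \<bar>ln C\<bar> + pi)"
proof -
  obtain h where h: "h holomorphic_on D" "h 0 = 0"
    "\<And>z. z \<in> D \<Longrightarrow> exp (h z) = partition_fun adj \<Lambda> z"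
    "\<And>z. z \<in> D \<Longrightarrow> cmod (h z) \<le> real (card \<Lambda>) * (ln 2 + \<bar>ln C\<bar> + pi)"
    using partition_fun_Ln_sum[OF G zf \<Lambda>] by blast
  have gh: "g z = h z" if "z \<in> D" for z
    by (rule continuous_log_unique[of D g h 0])
       (use D g h that in \<open>auto intro: holomorphic_on_imp_continuous_on\<close>)
  then show "g holomorphic_on D" using h(1) by (metis holomorphic_cong)
  show "cmod (g z) \<le> real (card \<Lambda>) * (ln 2 + \<bar>ln C\<bar> + pi)" if "z \<in> D" for z
    using gh h(4) that by simp
qed

text \<open>
  Vitali's theorem in the form needed here: by Montel it suffices that any two subsequential
  limits, possibly of different sequences in the family, agree.
\<close>

lemma vitali_common_limit:
  fixes F :: "(nat \<Rightarrow> complex \<Rightarrow> complex) set"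
  assumes S: "open S" "connected S" "ball 0 \<rho> \<subseteq> S" "\<rho> > 0"
    and hol: "\<And>h n. h \<in> F \<Longrightarrow> h n holomorphic_on S"
    and bnd: "\<And>h n z. h \<in> F \<Longrightarrow> z \<in> S \<Longrightarrow> cmod (h n z) \<le> B"
    and h0: "\<And>h n. h \<in> F \<Longrightarrow> h n 0 = 0"
    and lim: "\<And>h z. h \<in> F \<Longrightarrow> z \<in> ball 0 \<rho> - {0} \<Longrightarrow> (\<lambda>n. deriv (h n) z) \<longlonglongrightarrow> L z"
  shows "\<exists>f. f holomorphic_on S \<and>
    (\<forall>h\<in>F. \<forall>K. compact K \<and> K \<subseteq> S \<longrightarrow> uniform_limit K h f sequentially)"
proof (cases "F = {}")
  case True
  then show ?thesis by (intro exI[of _ "\<lambda>_. 0"]) auto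
next
  case False
  have subseq: "\<exists>f s. f holomorphic_on S \<and> strict_mono s \<and>
      (\<forall>z\<in>S. (\<lambda>n. h (r (s n)) z) \<longlonglongrightarrow> f z) \<and>
      (\<forall>K. compact K \<and> K \<subseteq> S \<longrightarrow> uniform_limit K (\<lambda>n. h (r (s n))) f sequentially)"
    if h: "h \<in> F" for h and r :: "nat \<Rightarrow> nat"
  proof -
    obtain f s where "f holomorphic_on S" "strict_mono (s :: nat \<Rightarrow> nat)"
      "\<And>z. z \<in> S \<Longrightarrow> (\<lambda>n. (\<lambda>n. h (r n)) (s n) z) \<longlonglongrightarrow> f z"
      "\<And>K. \<lbrakk>compact K; K \<subseteq> S\<rbrakk> \<Longrightarrow> uniform_limit K ((\<lambda>n. h (r n)) \<circ> s) f sequentially"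
      by (rule Montel[OF S(1), of "range h" "\<lambda>n. h (r n)"]) (use hol bnd h in blast)+
    then show ?thesis unfolding o_def by blast
  qed
  have deriv_lim: "deriv f z = L z"
    if h: "h \<in> F" and r: "strict_mono (r :: nat \<Rightarrow> nat)" and f: "f holomorphic_on S"
      and u: "\<And>K. compact K \<and> K \<subseteq> S \<Longrightarrow> uniform_limit K (\<lambda>n. h (r n)) f sequentially"
      and z: "z \<in> ball 0 \<rho> - {0}" for h r f z
  proof -
    have "z \<in> S" using z S by auto
    then obtain e where e: "e > 0" "cball z e \<subseteq> S"
      using S(1) open_contains_cball by blast
    have "(\<lambda>n. deriv (h (r n)) z) \<longlonglongrightarrow> deriv f z"
    proof (rule deriv_complex_uniform_limit[where A = "ball z e"])
      show "uniform_limit (ball z e) (\<lambda>n. h (r n)) f sequentially"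
        by (rule uniform_limit_on_subset[OF u[of "cball z e"]]) (use e in auto)
      have "h (r n) holomorphic_on ball z e" for n
        using hol[OF h] e ball_subset_cball holomorphic_on_subset by blast
      then show "\<forall>\<^sub>F n in sequentially. h (r n) holomorphic_on ball z e" by simp
    qed (use e in auto)
    moreover have "(\<lambda>n. deriv (h (r n)) z) \<longlonglongrightarrow> L z"
      using LIMSEQ_subseq_LIMSEQ[OF lim[OF h z] r] by (simp add: o_def)
    ultimately show ?thesis by (rule LIMSEQ_unique)
  qed
  \<comment> \<open>The identity theorem is applied to the derivative of \<open>f - f'\<close> on a
    punctured disc, as \<open>L\<close> is prescribed only away from 0. The common value at 0 then
    fixes the constant.\<close>
  have agree: "f z = f' z"
    if "f holomorphic_on S" "f' holomorphic_on S" "f 0 = 0" "f' 0 = 0"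
      and d: "\<And>z. z \<in> ball 0 \<rho> - {0} \<Longrightarrow> deriv f z = deriv f' z" and z: "z \<in> S" for f f' z
  proof -
    have hf: "(\<lambda>z. f z - f' z) holomorphic_on S" using that by (intro holomorphic_intros)
    have S0: "0 \<in> S" using S by auto
    have d0: "deriv (\<lambda>z. f z - f' z) w = 0" if w: "w \<in> S" for w
    proof (rule analytic_continuation[of "deriv (\<lambda>z. f z - f' z)" S "ball 0 \<rho> - {0}" 0])
      show "deriv (\<lambda>z. f z - f' z) holomorphic_on S" using hf S(1) by (rule holomorphic_deriv)
      show "0 islimpt ball 0 \<rho> - {0 :: complex}"
        using S(4) by (simp add: islimpt_ball islimpt_punctured[symmetric])
      fix z :: complex assume z: "z \<in> ball 0 \<rho> - {0}"
      then have "z \<in> S" using S by auto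
      then have "f field_differentiable at z" "f' field_differentiable at z"
        using \<open>f holomorphic_on S\<close> \<open>f' holomorphic_on S\<close> S(1) holomorphic_on_imp_differentiable_at by blast+
      then show "deriv (\<lambda>z. f z - f' z) z = 0" using d[OF z] by simp
    qed (use S S0 w in auto)
    have "f z - f' z = f 0 - f' 0"
    proof (rule DERIV_zero_connected_constant[of S "{}" "\<lambda>z. f z - f' z"])
      show "\<forall>x\<in>S - {}. ((\<lambda>z. f z - f' z) has_field_derivative 0) (at x)"
        using d0 holomorphic_derivI[OF hf S(1)] by force
    qed (use S S0 z hf in \<open>auto intro: holomorphic_on_imp_continuous_on\<close>)
    then show ?thesis using that by simp
  qed
  have zero: "f 0 = 0" if "h \<in> F" "(\<lambda>n. h (r n) 0) \<longlonglongrightarrow> f 0" for f :: "complex \<Rightarrow> complex" and h r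
    using that h0[OF that(1)] by (simp add: LIMSEQ_const_iff)
  have S0: "0 \<in> S" using S by auto
  obtain h0 where h0F: "h0 \<in> F" using False by blast
  obtain f s where f: "f holomorphic_on S" "strict_mono (s :: nat \<Rightarrow> nat)"
      "\<And>z. z \<in> S \<Longrightarrow> (\<lambda>n. h0 (s n) z) \<longlonglongrightarrow> f z"
      "\<And>K. compact K \<and> K \<subseteq> S \<Longrightarrow> uniform_limit K (\<lambda>n. h0 (s n)) f sequentially"
    using subseq[OF h0F, of "\<lambda>n. n"] by blast
  have f0: "f 0 = 0" using zero[where h = h0 and r = s and f = f, OF h0F f(3)[OF S0]] .
  have fL: "deriv f z = L z" if "z \<in> ball 0 \<rho> - {0}" for z
    by (rule deriv_lim[OF h0F f(2,1,4) that])
  have "uniform_limit K h f sequentially" if h: "h \<in> F" and K: "compact K" "K \<subseteq> S" for h K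
  proof (rule ccontr)
    assume "\<not> uniform_limit K h f sequentially"
    then obtain e where e: "e > 0" "\<And>N. \<exists>n\<ge>N. \<exists>x\<in>K. \<not> dist (h n x) (f x) < e"
      unfolding uniform_limit_iff eventually_sequentially by auto
    \<comment> \<open>If uniform convergence fails, the bad indices are infinite in number; a
      normal-family limit along them must again be \<open>f\<close>, which makes some of them
      good.\<close>
    define A where "A = {n. \<exists>x\<in>K. \<not> dist (h n x) (f x) < e}"
    have infA: "infinite A" unfolding infinite_nat_iff_unbounded_le A_def using e(2) by blast
    define r where "r = enumerate A"
    have r: "strict_mono r" "\<And>n. r n \<in> A"
      using infA by (auto simp: r_def strict_mono_enumerate enumerate_in_set)
    obtain f' s' where f': "f' holomorphic_on S" "strict_mono (s' :: nat \<Rightarrow> nat)"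
      "\<And>z. z \<in> S \<Longrightarrow> (\<lambda>n. h (r (s' n)) z) \<longlonglongrightarrow> f' z"
      "\<And>K. compact K \<and> K \<subseteq> S \<Longrightarrow> uniform_limit K (\<lambda>n. h (r (s' n))) f' sequentially"
      using subseq[OF h, of r] by blast
    have rs: "strict_mono (\<lambda>n. r (s' n))"
      using r(1) f'(2) by (simp add: strict_mono_def)
    have "f' 0 = 0" using zero[where h = h and r = "\<lambda>n. r (s' n)" and f = f', OF h f'(3)[OF S0]] .
    moreover have "deriv f' z = L z" if "z \<in> ball 0 \<rho> - {0}" for z
      by (rule deriv_lim[OF h rs f'(1,4) that])
    ultimately have ff': "f' z = f z" if "z \<in> S" for z
      using agree[OF f'(1) f(1) _ f0 _ that] fL by simp
    have "\<forall>\<^sub>F n in sequentially. \<forall>x\<in>K. dist (h (r (s' n)) x) (f' x) < e"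
      using f'(4)[of K] K e(1) unfolding uniform_limit_iff by blast
    then obtain n where "\<forall>x\<in>K. dist (h (r (s' n)) x) (f' x) < e"
      unfolding eventually_sequentially by blast
    then have "\<forall>x\<in>K. dist (h (r (s' n)) x) (f x) < e"
      using ff' K(2) by (metis subsetD)
    then have "r (s' n) \<notin> A" by (simp add: A_def)
    with r(2) show False by blast
  qed
  then show ?thesis using f(1) by blast
qed

section \<open>Locality near the origin\<close>

text \<open>The probability that \<open>v\<close> is occupied, divided by \<open>z\<close>.\<close>

definition vertex_weight :: "('a \<Rightarrow> 'a \<Rightarrow> bool) \<Rightarrow> 'a set \<Rightarrow> 'a \<Rightarrow> complex \<Rightarrow> complex" where
  "vertex_weight adj \<Lambda> v z = partition_fun adj (\<Lambda> - {v} - nbrs adj v) z / partition_fun adj \<Lambda> z"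

text \<open>Double counting of pairs \<open>v \<in> I\<close>. The factor \<open>z\<close> raises
  the exponent \<open>card I - 1\<close> to \<open>card I\<close>, which also treats the empty set
  correctly.\<close>

lemma deriv_partition_fun:
  fixes adj :: "'a \<Rightarrow> 'a \<Rightarrow> bool"
  assumes G: "simple_graph adj" and \<Lambda>: "finite \<Lambda>"
  shows "z * deriv (partition_fun adj \<Lambda>) z = (\<Sum>v\<in>\<Lambda>. z * partition_fun adj (\<Lambda> - {v} - nbrs adj v) z)"
proof -
  let ?A = "{I. I \<subseteq> \<Lambda> \<and> independent_set adj I}"
  have finA: "finite ?A" using \<Lambda> by (rule finite_indep)
  have "(partition_fun adj \<Lambda> has_field_derivative (\<Sum>I\<in>?A. of_nat (card I) * z ^ (card I - 1))) (at z)"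
    unfolding partition_fun_def by (auto intro!: derivative_eq_intros sum.cong)
  then have "z * deriv (partition_fun adj \<Lambda>) z = (\<Sum>I\<in>?A. z * (of_nat (card I) * z ^ (card I - 1)))"
    by (simp add: DERIV_imp_deriv sum_distrib_left)
  also have "\<dots> = (\<Sum>I\<in>?A. \<Sum>v\<in>\<Lambda>. if v \<in> I then z ^ card I else 0)"
  proof (rule sum.cong[OF refl])
    fix I assume I: "I \<in> ?A"
    then have "finite I" using \<Lambda> finite_subset by auto
    have "(\<Sum>v\<in>\<Lambda>. if v \<in> I then z ^ card I else 0) = (\<Sum>v\<in>I. z ^ card I)"
      using I \<Lambda> by (simp add: sum.If_cases Int_absorb1)
    also have "\<dots> = z * (of_nat (card I) * z ^ (card I - 1))"
      by (cases "card I") auto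
    finally show "z * (of_nat (card I) * z ^ (card I - 1)) = (\<Sum>v\<in>\<Lambda>. if v \<in> I then z ^ card I else 0)"
      by simp
  qed
  also have "\<dots> = (\<Sum>v\<in>\<Lambda>. \<Sum>I\<in>?A. if v \<in> I then z ^ card I else 0)" by (rule sum.swap)
  also have "\<dots> = (\<Sum>v\<in>\<Lambda>. z * partition_fun adj (\<Lambda> - {v} - nbrs adj v) z)"
  proof (rule sum.cong[OF refl])
    fix v assume v: "v \<in> \<Lambda>"
    then have ins: "insert v (\<Lambda> - {v}) = \<Lambda>" by auto
    have "(\<Sum>I\<in>?A. if v \<in> I then z ^ card I else 0)
        = (\<Sum>I\<in>{I. I \<subseteq> insert v (\<Lambda> - {v}) \<and> independent_set adj I \<and> v \<in> I}. z ^ card I)"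
      unfolding ins using finA by (simp add: sum.inter_filter[symmetric] conj_assoc)
    also have "\<dots> = z * partition_fun adj (\<Lambda> - {v} - nbrs adj v) z"
      using \<Lambda> by (subst sum_indep_insert[OF G]) (auto simp: partition_fun_def)
    finally show "(\<Sum>I\<in>?A. if v \<in> I then z ^ card I else 0)
        = z * partition_fun adj (\<Lambda> - {v} - nbrs adj v) z" .
  qed
  finally show ?thesis .
qed

lemma deriv_log_partition_fun:
  fixes adj :: "'a \<Rightarrow> 'a \<Rightarrow> bool"
  assumes G: "simple_graph adj" and \<Lambda>: "finite \<Lambda>" and S: "open S" "z \<in> S" and z: "z \<noteq> 0"
    and g: "g holomorphic_on S" "\<And>w. w \<in> S \<Longrightarrow> exp (g w) = partition_fun adj \<Lambda> w"
  shows "deriv g z = (\<Sum>v\<in>\<Lambda>. vertex_weight adj \<Lambda> v z)"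
proof -
  have dg: "(g has_field_derivative deriv g z) (at z)"
    using g(1) S by (rule holomorphic_derivI)
  have "((\<lambda>w. exp (g w)) has_field_derivative (exp (g z) * deriv g z)) (at z)"
    by (rule DERIV_fun_exp[OF dg])
  then have "(partition_fun adj \<Lambda> has_field_derivative (exp (g z) * deriv g z)) (at z)"
    by (rule has_field_derivative_transform_within_open[OF _ S]) (rule g(2))
  then have "deriv (partition_fun adj \<Lambda>) z = partition_fun adj \<Lambda> z * deriv g z"
    using g(2)[OF S(2)] by (simp add: DERIV_imp_deriv)
  then have "z * (partition_fun adj \<Lambda> z * deriv g z) = z * (\<Sum>v\<in>\<Lambda>. partition_fun adj (\<Lambda> - {v} - nbrs adj v) z)"
    using deriv_partition_fun[OF G \<Lambda>, of z] by (simp add: sum_distrib_left)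
  then have "partition_fun adj \<Lambda> z * deriv g z = (\<Sum>v\<in>\<Lambda>. partition_fun adj (\<Lambda> - {v} - nbrs adj v) z)"
    using z by simp
  moreover have "partition_fun adj \<Lambda> z \<noteq> 0" using g(2)[OF S(2)] by (metis exp_not_eq_zero)
  ultimately have "deriv g z = (\<Sum>v\<in>\<Lambda>. partition_fun adj (\<Lambda> - {v} - nbrs adj v) z) / partition_fun adj \<Lambda> z"
    by (simp add: field_simps)
  then show ?thesis by (simp add: vertex_weight_def sum_divide_distrib)
qed

lemma vertex_weight_ratio:
  assumes G: "simple_graph adj" and \<Lambda>: "finite \<Lambda>" "v \<in> \<Lambda>" and z: "z \<noteq> 0"
    and nz: "partition_fun adj (\<Lambda> - {v}) z \<noteq> 0"
  shows "vertex_weight adj \<Lambda> v z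
    = hc_ratio adj (\<Lambda> - {v}) v z / (1 + hc_ratio adj (\<Lambda> - {v}) v z) / z"
proof -
  define P where "P = partition_fun adj (\<Lambda> - {v}) z"
  define Q where "Q = partition_fun adj (\<Lambda> - {v} - nbrs adj v) z"
  have ins: "insert v (\<Lambda> - {v}) = \<Lambda>" using \<Lambda> by auto
  have "partition_fun adj \<Lambda> z = P + z * Q"
    using partition_fun_insert[OF G, of "\<Lambda> - {v}" v z, unfolded ins] \<Lambda> by (simp add: P_def Q_def)
  then have 1: "vertex_weight adj \<Lambda> v z = Q / (P + z * Q)" by (simp add: vertex_weight_def Q_def)
  have 2: "hc_ratio adj (\<Lambda> - {v}) v z = z * Q / P" by (simp add: hc_ratio_def P_def Q_def)
  have P: "P \<noteq> 0" using nz by (simp add: P_def)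
  then have "1 + z * Q / P = (P + z * Q) / P" by (simp add: field_simps)
  then show ?thesis unfolding 1 2 using P z by simp
qed

lemma dist_le_refl [simp]: "dist_le adj r v v"
  unfolding dist_le_def by (intro exI[of _ 0]) auto

lemma dist_le_step: "adj v u \<Longrightarrow> dist_le adj r u w \<Longrightarrow> dist_le adj (Suc r) v w"
  unfolding dist_le_def by (meson relpowp_Suc_I2 Suc_le_mono)

lemma dist_le_mono: "dist_le adj r v w \<Longrightarrow> r \<le> s \<Longrightarrow> dist_le adj s v w"
  unfolding dist_le_def by (meson order_trans)

lemma finite_dist_le:
  assumes "locally_finite adj"
  shows "finite {u. dist_le adj r v u}"
proof -
  have fin: "finite {u. (adj ^^ k) v u}" for k
  proof (induction k)
    case (Suc k)
    have "{u. (adj ^^ Suc k) v u} = (\<Union>w\<in>{w. (adj ^^ k) v w}. nbrs adj w)"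
      by (auto simp: OO_def)
    then show ?case using Suc assms by (simp add: locally_finite_def)
  qed simp
  have "{u. dist_le adj r v u} = (\<Union>k\<le>r. {u. (adj ^^ k) v u})"
    by (auto simp: dist_le_def)
  then show ?thesis using fin by simp
qed

text \<open>Equal balls of radius at least 1 give equal neighbour lists, so both recursions run over
  the same list. Halving the factors puts them into the unit disc, where a difference of products is
  at most the sum of the differences. The bound on \<open>z\<close> is chosen so that
  \<open>cmod z * 2 ^ m * m * 2\<close> is at most 1/2: each unit of distance gains a factor
  2.\<close>

lemma hc_ratio_local:
  fixes adj :: "'a \<Rightarrow> 'a \<Rightarrow> bool"
  assumes G: "simple_graph adj"
    and deg: "\<And>v. finite (nbrs adj v)" "\<And>v. card (nbrs adj v) \<le> m"
    and z: "cmod z \<le> 1 / (4 * (real m + 1) * 2 ^ m)"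
  shows "finite S \<Longrightarrow> finite S' \<Longrightarrow> v \<notin> S \<Longrightarrow> v \<notin> S' \<Longrightarrow>
    (\<And>u. dist_le adj r v u \<Longrightarrow> u \<in> S \<longleftrightarrow> u \<in> S') \<Longrightarrow>
    cmod (hc_ratio adj S v z - hc_ratio adj S' v z) \<le> 1 / 2 ^ r"
proof (induction r arbitrary: v S S')
  have zs: "cmod z \<le> 1 / 2 ^ Suc m"
  proof -
    have "(2::real) ^ Suc m \<le> 4 * (real m + 1) * 2 ^ m" by simp
    then have "1 / (4 * (real m + 1) * 2 ^ m) \<le> 1 / (2::real) ^ Suc m" by (intro divide_left_mono) auto
    with z show ?thesis by simp
  qed
  note sm = hc_ratio_small_disc[OF G deg zs]
  {
    case 0
    then have "cmod (hc_ratio adj S v z) \<le> 1 / 2" "cmod (hc_ratio adj S' v z) \<le> 1 / 2"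
      using sm by auto
    then show ?case
      using norm_triangle_ineq4[of "hc_ratio adj S v z" "hc_ratio adj S' v z"] by simp
  next
    case (Suc r)
    obtain us where us: "distinct us" "set us = nbrs adj v \<inter> S"
      using finite_distinct_list[of "nbrs adj v \<inter> S"] deg by auto
    have adj_d: "dist_le adj (Suc r) v u" if "adj v u" for u
      using that by (rule dist_le_step) simp
    have us': "set us = nbrs adj v \<inter> S'" using us Suc.prems(5)[OF adj_d] by auto
    have len: "length us \<le> m"
    proof -
      have "length us = card (nbrs adj v \<inter> S)" using us by (metis distinct_card)
      also have "\<dots> \<le> card (nbrs adj v)" using deg by (intro card_mono) auto
      finally show ?thesis using deg(2)[of v] by simp
    qed
    define x where "x = (\<lambda>i. hc_ratio adj (S - set (take (Suc i) us)) (us ! i) z)"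
    define y where "y = (\<lambda>i. hc_ratio adj (S' - set (take (Suc i) us)) (us ! i) z)"
    have xy: "cmod (x i) \<le> 1 / 2" "cmod (y i) \<le> 1 / 2" "cmod (x i - y i) \<le> 1 / 2 ^ r"
      if i: "i < length us" for i
    proof -
      have u: "us ! i \<in> set (take (Suc i) us)" using i by (simp add: take_Suc_conv_app_nth)
      then show "cmod (x i) \<le> 1 / 2" "cmod (y i) \<le> 1 / 2"
        using sm Suc.prems unfolding x_def y_def by auto
      have vu: "adj v (us ! i)" using i us nth_mem[of i us] by auto
      show "cmod (x i - y i) \<le> 1 / 2 ^ r"
        unfolding x_def y_def
      proof (rule Suc.IH)
        fix w assume "dist_le adj r (us ! i) w"
        then have "w \<in> S \<longleftrightarrow> w \<in> S'" using Suc.prems(5) dist_le_step[of adj, OF vu] by blast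
        then show "w \<in> S - set (take (Suc i) us) \<longleftrightarrow> w \<in> S' - set (take (Suc i) us)" by auto
      qed (use u Suc.prems in auto)
    qed
    have inv: "cmod (inverse (1 + w)) \<le> 2" "1 + w \<noteq> 0" if "cmod w \<le> 1 / 2" for w :: complex
    proof -
      have h: "1 / 2 \<le> cmod (1 + w)" using norm_diff_ineq[of 1 w] that by simp
      then have "inverse (cmod (1 + w)) \<le> inverse (1 / 2)" by (intro le_imp_inverse_le) auto
      then show "cmod (inverse (1 + w)) \<le> 2" by (simp add: norm_inverse)
      show "1 + w \<noteq> 0" using h by auto
    qed
    let ?a = "\<lambda>i. inverse (1 + x i) / 2" and ?b = "\<lambda>i. inverse (1 + y i) / 2"
    have "cmod ((\<Prod>i<length us. ?a i) - (\<Prod>i<length us. ?b i)) \<le> (\<Sum>i<length us. cmod (?a i - ?b i))"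
    proof (rule norm_prod_diff)
      fix i assume "i \<in> {..<length us}"
      then show "cmod (?a i) \<le> 1" "cmod (?b i) \<le> 1"
        using inv(1)[OF xy(1)] inv(1)[OF xy(2)] by (auto simp: norm_divide)
    qed
    also have "\<dots> \<le> (\<Sum>i<length us. 2 * (1 / 2 ^ r))"
    proof (rule sum_mono)
      fix i assume "i \<in> {..<length us}"
      then have i: "i < length us" by simp
      have "?a i - ?b i = (inverse (1 + x i) - inverse (1 + y i)) / 2"
        by (simp only: diff_divide_distrib)
      also have "inverse (1 + x i) - inverse (1 + y i)
          = - (inverse (1 + x i) * ((1 + x i) - (1 + y i)) * inverse (1 + y i))"
        by (rule inverse_diff_inverse) (use inv(2)[OF xy(1)[OF i]] inv(2)[OF xy(2)[OF i]] in auto)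
      also have "\<dots> = (y i - x i) * (inverse (1 + x i) * inverse (1 + y i))"
        by (simp add: algebra_simps)
      finally have "cmod (?a i - ?b i) = cmod (x i - y i) * (cmod (inverse (1 + x i)) * cmod (inverse (1 + y i))) / 2"
        by (simp only: norm_mult norm_divide norm_minus_commute) simp
      also have "\<dots> \<le> 1 / 2 ^ r * (2 * 2) / 2"
        using inv(1)[OF xy(1)[OF i]] inv(1)[OF xy(2)[OF i]] xy(3)[OF i]
        by (intro divide_right_mono mult_mono) auto
      finally show "cmod (?a i - ?b i) \<le> 2 * (1 / 2 ^ r)" by simp
    qed
    also have "\<dots> \<le> real m * (2 * (1 / 2 ^ r))"
      using len by (simp add: divide_right_mono)
    finally have d: "cmod ((\<Prod>i<length us. ?a i) - (\<Prod>i<length us. ?b i)) \<le> real m * (2 * (1 / 2 ^ r))" .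
    have nzA: "partition_fun adj A z \<noteq> 0" if "finite A" for A using sm[OF that] by blast
    have "hc_ratio adj S v z = z * (\<Prod>i<length us. inverse (1 + x i))"
      unfolding x_def by (rule hc_ratio_recursion[OF G Suc.prems(1) us]) (use Suc.prems finite_subset nzA in blast)
    also have "\<dots> = z * 2 ^ length us * (\<Prod>i<length us. ?a i)" by (simp add: prod_dividef)
    finally have 1: "hc_ratio adj S v z = z * 2 ^ length us * (\<Prod>i<length us. ?a i)" .
    have "hc_ratio adj S' v z = z * (\<Prod>i<length us. inverse (1 + y i))"
      unfolding y_def by (rule hc_ratio_recursion[OF G Suc.prems(2) us(1) us']) (use Suc.prems finite_subset nzA in blast)
    also have "\<dots> = z * 2 ^ length us * (\<Prod>i<length us. ?b i)" by (simp add: prod_dividef)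
    finally have 2: "hc_ratio adj S' v z = z * 2 ^ length us * (\<Prod>i<length us. ?b i)" .
    have "cmod (hc_ratio adj S v z - hc_ratio adj S' v z)
      = cmod z * 2 ^ length us * cmod ((\<Prod>i<length us. ?a i) - (\<Prod>i<length us. ?b i))"
      unfolding 1 2 right_diff_distrib[symmetric] norm_mult norm_power by simp
    also have "\<dots> \<le> (1 / (4 * (real m + 1) * 2 ^ m)) * 2 ^ m * (real m * (2 * (1 / 2 ^ r)))"
      using z d len by (intro mult_mono power_increasing) auto
    also have "\<dots> \<le> (1 / (4 * (real m + 1) * 2 ^ m)) * 2 ^ m * ((real m + 1) * (2 * (1 / 2 ^ r)))"
      by (intro mult_left_mono mult_right_mono) auto
    also have "\<dots> = 1 / 2 ^ Suc r"
    proof -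
      have cancel: "1 / (4 * a * b) * b * (a * (2 * (1 / c))) = 1 / (2 * c)"
        if "a > 0" "b > 0" "c > 0" for a b c :: real
        using that by (simp add: field_simps)
      show ?thesis unfolding power_Suc by (rule cancel) auto
    qed
    finally show ?case .
  }
qed

text \<open>The map \<open>x / (1 + x)\<close> stays below 1 in modulus and expands distances at
  most fourfold on the disc of radius 1/2.\<close>

lemma vertex_weight_local:
  fixes adj :: "'a \<Rightarrow> 'a \<Rightarrow> bool"
  assumes G: "simple_graph adj"
    and deg: "\<And>v. finite (nbrs adj v)" "\<And>v. card (nbrs adj v) \<le> m"
    and z: "cmod z \<le> 1 / (4 * (real m + 1) * 2 ^ m)" "z \<noteq> 0"
    and \<Lambda>: "finite \<Lambda>" "v \<in> \<Lambda>"
  shows "cmod (vertex_weight adj \<Lambda> v z) \<le> 1 / cmod z"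
    and "finite \<Lambda>' \<Longrightarrow> v \<in> \<Lambda>' \<Longrightarrow> (\<And>u. dist_le adj r v u \<Longrightarrow> u \<in> \<Lambda> \<longleftrightarrow> u \<in> \<Lambda>') \<Longrightarrow>
      cmod (vertex_weight adj \<Lambda> v z - vertex_weight adj \<Lambda>' v z) \<le> 4 / cmod z / 2 ^ r"
proof -
  have zs: "cmod z \<le> 1 / 2 ^ Suc m"
  proof -
    have "(2::real) ^ Suc m \<le> 4 * (real m + 1) * 2 ^ m" by simp
    then have "1 / (4 * (real m + 1) * 2 ^ m) \<le> 1 / (2::real) ^ Suc m" by (intro divide_left_mono) auto
    with z show ?thesis by simp
  qed
  note sm = hc_ratio_small_disc[OF G deg zs]
  have inv: "1 / 2 \<le> cmod (1 + w)" "1 + w \<noteq> 0" if "cmod w \<le> 1 / 2" for w :: complex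
  proof -
    show h: "1 / 2 \<le> cmod (1 + w)" using norm_diff_ineq[of 1 w] that by simp
    then show "1 + w \<noteq> 0" by auto
  qed
  define x where "x = hc_ratio adj (\<Lambda> - {v}) v z"
  have x: "cmod x \<le> 1 / 2" "vertex_weight adj \<Lambda> v z = x / (1 + x) / z"
    using sm[of "\<Lambda> - {v}"] \<Lambda> z vertex_weight_ratio[OF G \<Lambda>, of z] by (auto simp: x_def)
  have "cmod x / cmod (1 + x) \<le> (1 / 2) / (1 / 2)"
    using inv[OF x(1)] x(1) by (intro frac_le) auto
  then show "cmod (vertex_weight adj \<Lambda> v z) \<le> 1 / cmod z"
    unfolding x(2) norm_divide by (intro divide_right_mono) auto
  assume \<Lambda>': "finite \<Lambda>'" "v \<in> \<Lambda>'" "\<And>u. dist_le adj r v u \<Longrightarrow> u \<in> \<Lambda> \<longleftrightarrow> u \<in> \<Lambda>'"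
  define y where "y = hc_ratio adj (\<Lambda>' - {v}) v z"
  have y: "cmod y \<le> 1 / 2" "vertex_weight adj \<Lambda>' v z = y / (1 + y) / z"
    using sm[of "\<Lambda>' - {v}"] \<Lambda>' z vertex_weight_ratio[OF G \<Lambda>'(1,2), of z] by (auto simp: y_def)
  have d: "cmod (x - y) \<le> 1 / 2 ^ r"
    unfolding x_def y_def using \<Lambda> \<Lambda>' by (intro hc_ratio_local[OF G deg z(1)]) auto
  have "x / (1 + x) / z - y / (1 + y) / z = (x - y) / ((1 + x) * (1 + y)) / z"
    using inv(2)[OF x(1)] inv(2)[OF y(1)] z by (simp add: divide_simps) (simp add: algebra_simps)
  then have "cmod (vertex_weight adj \<Lambda> v z - vertex_weight adj \<Lambda>' v z)
      = cmod (x - y) / (cmod (1 + x) * cmod (1 + y)) / cmod z"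
    unfolding x(2) y(2) by (simp only: norm_mult norm_divide)
  also have "\<dots> \<le> (1 / 2 ^ r) / ((1 / 2) * (1 / 2)) / cmod z"
    using d inv(1)[OF x(1)] inv(1)[OF y(1)] by (intro divide_right_mono frac_le mult_mono) auto
  also have "\<dots> = 4 / cmod z / 2 ^ r" by (simp add: field_simps)
  finally show "cmod (vertex_weight adj \<Lambda> v z - vertex_weight adj \<Lambda>' v z) \<le> 4 / cmod z / 2 ^ r" .
qed

section \<open>Periodic graphs\<close>

lemma graph_automorphism_comp:
  "graph_automorphism adj f \<Longrightarrow> graph_automorphism adj g \<Longrightarrow> graph_automorphism adj (f \<circ> g)"
  by (auto simp: graph_automorphism_def bij_comp)

lemma graph_automorphism_inv:
  assumes "graph_automorphism adj f"
  shows "graph_automorphism adj (inv f)"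
proof -
  have f: "bij f" "\<And>u v. adj u v \<longleftrightarrow> adj (f u) (f v)"
    using assms by (auto simp: graph_automorphism_def)
  then have "f (inv f u) = u" for u by (simp add: bij_is_surj surj_f_inv_f)
  then have "adj u v \<longleftrightarrow> adj (inv f u) (inv f v)" for u v using f(2)[of "inv f u" "inv f v"] by simp
  then show ?thesis using f(1) by (simp add: graph_automorphism_def bij_imp_bij_inv)
qed

lemma gen_group_automorphism:
  assumes "\<And>i. i < d \<Longrightarrow> graph_automorphism adj (\<tau> i)" "g \<in> gen_group \<tau> d"
  shows "graph_automorphism adj g"
  using assms(2)
proof induction
  case gen_id
  then show ?case using bij_id unfolding graph_automorphism_def id_def by auto
qed (use assms(1) graph_automorphism_comp graph_automorphism_inv in blast)+

lemma gen_group_comp: "g \<in> gen_group \<tau> d \<Longrightarrow> h \<in> gen_group \<tau> d \<Longrightarrow> g \<circ> h \<in> gen_group \<tau> d"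
  by (induction rule: gen_group.induct) (auto simp: comp_assoc intro: gen_group.intros)

lemma gen_group_inv:
  assumes "\<And>i. i < d \<Longrightarrow> graph_automorphism adj (\<tau> i)" "g \<in> gen_group \<tau> d"
  shows "inv g \<in> gen_group \<tau> d"
  using assms(2)
proof induction
  case gen_id
  show ?case unfolding inv_id by (rule gen_group.gen_id)
next
  case (gen_step g i)
  have "bij (\<tau> i)" "bij g"
    using assms(1)[OF gen_step(2)] gen_group_automorphism[OF assms(1) gen_step(1)]
    by (auto simp: graph_automorphism_def)
  then have "inv (\<tau> i \<circ> g) = inv g \<circ> inv (\<tau> i)" by (rule o_inv_distrib)
  moreover have "inv (\<tau> i) \<in> gen_group \<tau> d"
    using gen_group.gen_step_inv[OF gen_group.gen_id gen_step(2)] by simp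
  ultimately show ?case using gen_step gen_group_comp by metis
next
  case (gen_step_inv g i)
  have b: "bij (\<tau> i)" "bij g"
    using assms(1)[OF gen_step_inv(2)] gen_group_automorphism[OF assms(1) gen_step_inv(1)]
    by (auto simp: graph_automorphism_def)
  then have "inv (inv (\<tau> i) \<circ> g) = inv g \<circ> \<tau> i"
    using o_inv_distrib[of "inv (\<tau> i)" g] by (simp add: bij_imp_bij_inv inv_inv_eq)
  moreover have "\<tau> i \<in> gen_group \<tau> d"
    using gen_group.gen_step[OF gen_group.gen_id gen_step_inv(2)] by simp
  ultimately show ?case using gen_step_inv gen_group_comp by metis
qed

lemma relpowp_automorphism:
  assumes "graph_automorphism adj f" "(adj ^^ k) u v"
  shows "(adj ^^ k) (f u) (f v)"
  using assms(2)
proof (induction k arbitrary: v)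
  case (Suc k)
  then obtain w where "(adj ^^ k) u w" "adj w v" by auto
  then have "(adj ^^ k) (f u) (f w)" "adj (f w) (f v)"
    using Suc.IH assms(1) by (auto simp: graph_automorphism_def)
  then show ?case by auto
qed simp

lemma dist_le_automorphism:
  assumes f: "graph_automorphism adj f"
  shows "dist_le adj r (f u) (f v) \<longleftrightarrow> dist_le adj r u v"
proof
  have "inv f (f w) = w" for w using f by (simp add: graph_automorphism_def bij_is_inj)
  then show "dist_le adj r (f u) (f v) \<Longrightarrow> dist_le adj r u v"
    unfolding dist_le_def using relpowp_automorphism[OF graph_automorphism_inv[OF f]] by metis
  show "dist_le adj r u v \<Longrightarrow> dist_le adj r (f u) (f v)"
    unfolding dist_le_def using relpowp_automorphism[OF f] by blast
qed

lemma dist_le_sym: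
  assumes "simple_graph adj" "dist_le adj r u v"
  shows "dist_le adj r v u"
proof -
  have "(adj ^^ k) u v \<Longrightarrow> (adj ^^ k) v u" for k u v
  proof (induction k arbitrary: v)
    case (Suc k)
    then obtain w where "(adj ^^ k) u w" "adj w v" by auto
    then have "(adj ^^ k) w u" "adj v w" using Suc.IH assms(1) by (auto simp: simple_graph_def)
    then show ?case by (rule relpowp_Suc_I2[rotated])
  qed simp
  then show ?thesis using assms(2) unfolding dist_le_def by blast
qed

lemma nbrs_automorphism:
  assumes "graph_automorphism adj f"
  shows "nbrs adj (f v) = f ` nbrs adj v"
proof
  show "nbrs adj (f v) \<subseteq> f ` nbrs adj v"
  proof
    fix u assume u: "u \<in> nbrs adj (f v)"
    obtain w where "u = f w" using assms by (metis graph_automorphism_def bij_pointE)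
    then show "u \<in> f ` nbrs adj v" using u assms by (auto simp: graph_automorphism_def)
  qed
qed (use assms in \<open>auto simp: graph_automorphism_def\<close>)

lemma partition_fun_automorphism:
  assumes f: "graph_automorphism adj f"
  shows "partition_fun adj (f ` S) z = partition_fun adj S z"
proof -
  have inj: "inj f" and ad: "\<And>u v. adj (f u) (f v) \<longleftrightarrow> adj u v"
    using f by (auto simp: graph_automorphism_def bij_is_inj)
  have "{I. I \<subseteq> f ` S \<and> independent_set adj I} = (`) f ` {I. I \<subseteq> S \<and> independent_set adj I}"
    by (auto simp: subset_image_iff independent_set_def ad image_iff)
  moreover have "inj_on ((`) f) {I. I \<subseteq> S \<and> independent_set adj I}"
    using inj by (auto simp: inj_on_def inj_image_eq_iff)
  ultimately show ?thesis
    unfolding partition_fun_def using inj by (simp add: sum.reindex card_image inj_on_subset)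
qed

lemma vertex_weight_automorphism:
  assumes f: "graph_automorphism adj f"
  shows "vertex_weight adj (f ` \<Lambda>) (f v) z = vertex_weight adj \<Lambda> v z"
proof -
  have inj: "inj f" using f by (auto simp: graph_automorphism_def bij_is_inj)
  have "f ` \<Lambda> - {f v} - nbrs adj (f v) = f ` (\<Lambda> - {v} - nbrs adj v)"
    unfolding nbrs_automorphism[OF f] using inj by (simp add: image_set_diff)
  then show ?thesis by (simp add: vertex_weight_def partition_fun_automorphism[OF f])
qed

lemma ball_automorphism:
  assumes f: "graph_automorphism adj f"
  shows "{u. dist_le adj r (f v) u} = f ` {u. dist_le adj r v u}"
proof -
  have "\<exists>w. u = f w" for u using f by (metis graph_automorphism_def bij_pointE)
  then show ?thesis using dist_le_automorphism[OF f] by (auto simp: image_iff) metis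
qed

lemma finite_r_boundary:
  assumes "simple_graph adj" "locally_finite adj" "finite S"
  shows "finite (r_boundary adj r S)"
proof (rule finite_subset)
  show "r_boundary adj r S \<subseteq> (\<Union>u\<in>S. {v. dist_le adj r u v})"
    using dist_le_sym[OF assms(1)] by (auto simp: r_boundary_def)
qed (use assms finite_dist_le in auto)

section \<open>Free actions with finitely many orbits\<close>

locale periodic_graph =
  fixes adj :: "'a \<Rightarrow> 'a \<Rightarrow> bool" and \<Gamma> :: "('a \<Rightarrow> 'a) set" and F :: "'a set"
  assumes simple: "simple_graph adj" and conn: "graph_connected adj" and locfin: "locally_finite adj"
    and aut: "g \<in> \<Gamma> \<Longrightarrow> graph_automorphism adj g"
    and comp: "g \<in> \<Gamma> \<Longrightarrow> h \<in> \<Gamma> \<Longrightarrow> g \<circ> h \<in> \<Gamma>"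
    and inv: "g \<in> \<Gamma> \<Longrightarrow> inv g \<in> \<Gamma>"
    and free: "g \<in> \<Gamma> \<Longrightarrow> g v = v \<Longrightarrow> g = id"
    and finF: "finite F" and cover: "\<exists>g\<in>\<Gamma>. \<exists>p\<in>F. v = g p"
begin

text \<open>The predicate under \<open>SOME\<close> depends only on the orbit of \<open>v\<close>,
  so \<open>reps\<close> meets every orbit exactly once even if \<open>F\<close> meets it several
  times.\<close>

definition rep :: "'a \<Rightarrow> 'a" where
  "rep v = (SOME p. p \<in> F \<and> (\<exists>g\<in>\<Gamma>. v = g p))"

definition mover :: "'a \<Rightarrow> 'a \<Rightarrow> 'a" where
  "mover v = (SOME g. g \<in> \<Gamma> \<and> v = g (rep v))"

abbreviation reps :: "'a set" where
  "reps \<equiv> range rep"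

abbreviation cball_graph :: "nat \<Rightarrow> 'a \<Rightarrow> 'a set" where
  "cball_graph r v \<equiv> {u. dist_le adj r v u}"

lemma rep: "rep v \<in> F" "\<exists>g\<in>\<Gamma>. v = g (rep v)"
proof -
  have "\<exists>p. p \<in> F \<and> (\<exists>g\<in>\<Gamma>. v = g p)" using cover[of v] by blast
  then have "rep v \<in> F \<and> (\<exists>g\<in>\<Gamma>. v = g (rep v))"
    unfolding rep_def by (rule someI_ex)
  then show "rep v \<in> F" "\<exists>g\<in>\<Gamma>. v = g (rep v)" by auto
qed

lemma mover: "mover v \<in> \<Gamma>" "mover v (rep v) = v"
proof -
  have "\<exists>g. g \<in> \<Gamma> \<and> v = g (rep v)" using rep(2)[of v] by blast
  then have "mover v \<in> \<Gamma> \<and> v = mover v (rep v)"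
    unfolding mover_def by (rule someI_ex)
  then show "mover v \<in> \<Gamma>" "mover v (rep v) = v" by auto
qed

lemma inv_apply: "g \<in> \<Gamma> \<Longrightarrow> inv g (g v) = v"
  using aut[of g] by (simp add: graph_automorphism_def bij_is_inj)

lemma rep_act:
  assumes g: "g \<in> \<Gamma>"
  shows "rep (g v) = rep v"
proof -
  have "(\<exists>h\<in>\<Gamma>. g v = h p) \<longleftrightarrow> (\<exists>h\<in>\<Gamma>. v = h p)" for p
  proof
    assume "\<exists>h\<in>\<Gamma>. g v = h p"
    then obtain h where h: "h \<in> \<Gamma>" "g v = h p" by blast
    then have "v = (inv g \<circ> h) p" using inv_apply[OF g, of v] by simp
    then show "\<exists>h\<in>\<Gamma>. v = h p" using comp[OF inv[OF g] h(1)] by blast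
  next
    assume "\<exists>h\<in>\<Gamma>. v = h p"
    then obtain h where h: "h \<in> \<Gamma>" "v = h p" by blast
    then have "g v = (g \<circ> h) p" by simp
    then show "\<exists>h\<in>\<Gamma>. g v = h p" using comp[OF g h(1)] by blast
  qed
  then show ?thesis by (simp add: rep_def)
qed

lemma rep_reps: "p \<in> reps \<Longrightarrow> rep p = p"
  using mover rep_act by (metis rangeE)

lemma finite_reps: "finite reps"
  using finF rep(1) by (meson finite_subset image_subsetI)

lemma degree_bound:
  shows "finite (nbrs adj v)" "card (nbrs adj v) \<le> (\<Sum>p\<in>F. card (nbrs adj p))"
proof -
  show "finite (nbrs adj v)" using locfin by (simp add: locally_finite_def)
  have a: "graph_automorphism adj (mover v)" using mover(1) by (rule aut)
  have "card (nbrs adj v) = card (nbrs adj (mover v (rep v)))" by (simp add: mover)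
  also have "\<dots> \<le> card (nbrs adj (rep v))"
    unfolding nbrs_automorphism[OF a] using locfin by (intro card_image_le) (simp add: locally_finite_def)
  also have "\<dots> \<le> (\<Sum>p\<in>F. card (nbrs adj p))"
    using finF rep(1) by (intro member_le_sum) auto
  finally show "card (nbrs adj v) \<le> (\<Sum>p\<in>F. card (nbrs adj p))" .
qed

text \<open>Freeness enters here: \<open>inv (mover u) \<circ> mover v\<close> fixes
  \<open>p\<close>, hence is the identity. The injectivity obtained on each orbit is what makes all
  orbits equally dense.\<close>

lemma mover_free:
  assumes "mover v p = mover u p" "rep v = rep u"
  shows "v = u"
proof -
  have "(inv (mover u) \<circ> mover v) p = p" using assms(1) inv_apply[OF mover(1)] by simp
  then have "inv (mover u) \<circ> mover v = id"
    using free[OF comp[OF inv[OF mover(1)] mover(1)]] by blast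
  then have "inv (mover u) (mover v (rep v)) = rep v" by (metis comp_apply id_apply)
  then have "inv (mover u) v = rep u" by (metis mover(2) assms(2))
  moreover have "mover u (inv (mover u) v) = v"
    using aut[OF mover(1)[of u]] by (simp add: graph_automorphism_def bij_is_surj surj_f_inv_f)
  ultimately show ?thesis using mover(2)[of u] by simp
qed

text \<open>Each \<open>v = mover v p\<close> has the companion \<open>mover v p'\<close> within
  distance \<rho>. Companions of different vertices differ, and a companion outside \<Lambda> puts
  \<open>v\<close> into the boundary.\<close>

lemma orbit_count_le:
  assumes p: "p \<in> reps" "p' \<in> reps" and d: "dist_le adj \<rho> p p'" and \<Lambda>: "finite \<Lambda>"
  shows "card {v\<in>\<Lambda>. rep v = p} \<le> card {v\<in>\<Lambda>. rep v = p'} + card (r_boundary adj \<rho> \<Lambda>)"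
proof -
  let ?\<beta> = "\<lambda>v. mover v p'"
  let ?A = "{v\<in>\<Lambda>. rep v = p \<and> ?\<beta> v \<in> \<Lambda>}" and ?B = "{v\<in>\<Lambda>. rep v = p \<and> ?\<beta> v \<notin> \<Lambda>}"
  have "{v\<in>\<Lambda>. rep v = p} = ?A \<union> ?B" by auto
  then have "card {v\<in>\<Lambda>. rep v = p} \<le> card ?A + card ?B" by (simp add: card_Un_le)
  also have "card ?A \<le> card {v\<in>\<Lambda>. rep v = p'}"
  proof (rule card_inj_on_le[where f = ?\<beta>])
    show "inj_on ?\<beta> ?A" by (rule inj_onI) (use mover_free in auto)
    show "?\<beta> ` ?A \<subseteq> {v\<in>\<Lambda>. rep v = p'}"
      using rep_act[OF mover(1)] rep_reps[OF p(2)] by auto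
  qed (use \<Lambda> in auto)
  also have "card ?B \<le> card (r_boundary adj \<rho> \<Lambda>)"
  proof (rule card_mono)
    show "finite (r_boundary adj \<rho> \<Lambda>)" by (rule finite_r_boundary[OF simple locfin \<Lambda>])
    show "?B \<subseteq> r_boundary adj \<rho> \<Lambda>"
    proof
      fix v assume v: "v \<in> ?B"
      then have "dist_le adj \<rho> (mover v p) (mover v p')"
        using d dist_le_automorphism[OF aut[OF mover(1)]] by blast
      then have "dist_le adj \<rho> v (?\<beta> v)" using v mover(2)[of v] by auto
      then show "v \<in> r_boundary adj \<rho> \<Lambda>"
        using v unfolding r_boundary_def by (auto intro: dist_le_refl)
    qed
  qed
  finally show ?thesis by simp
qed

lemma ex_dist_le: "\<exists>\<rho>. dist_le adj \<rho> u v"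
proof -
  obtain k where "(adj ^^ k) u v"
    using conn rtranclp_imp_relpowp[of adj u v] by (auto simp: graph_connected_def)
  then show ?thesis unfolding dist_le_def by blast
qed

lemma sum_orbit_count:
  assumes "finite \<Lambda>"
  shows "(\<Sum>v\<in>\<Lambda>. f (rep v)) = (\<Sum>p\<in>reps. of_nat (card {v\<in>\<Lambda>. rep v = p}) * (f p :: 'b :: comm_semiring_1))"
proof -
  have "(\<Sum>v\<in>\<Lambda>. f (rep v)) = (\<Sum>p\<in>reps. \<Sum>v\<in>{v\<in>\<Lambda>. rep v = p}. f (rep v))"
    by (rule sum.group[symmetric]) (use assms finite_reps in auto)
  then show ?thesis by simp
qed

text \<open>Any two orbit counts differ by a vanishing fraction of the volume, and all of them add
  up to the volume.\<close>

lemma orbit_density: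
  assumes \<Lambda>: "folner_van_hove adj \<Lambda>" and p: "p \<in> reps"
  shows "(\<lambda>n. real (card {v\<in>\<Lambda> n. rep v = p}) / real (card (\<Lambda> n))) \<longlonglongrightarrow> 1 / real (card reps)"
proof -
  let ?c = "\<lambda>p n. real (card {v\<in>\<Lambda> n. rep v = p})"
  have fin: "finite (\<Lambda> n)" for n using \<Lambda> by (simp add: folner_van_hove_def)
  have bd: "(\<lambda>n. real (card (r_boundary adj r (\<Lambda> n))) / real (card (\<Lambda> n))) \<longlonglongrightarrow> 0" for r
    using \<Lambda> by (simp add: folner_van_hove_def)
  have diff: "(\<lambda>n. (?c p n - ?c p' n) / real (card (\<Lambda> n))) \<longlonglongrightarrow> 0" if p': "p' \<in> reps" for p'
  proof -
    obtain \<rho> where d: "dist_le adj \<rho> p p'" using ex_dist_le by blast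
    show ?thesis
    proof (rule Lim_null_comparison[OF _ bd[of \<rho>]], rule always_eventually, rule allI)
      fix n
      have "?c p n \<le> ?c p' n + real (card (r_boundary adj \<rho> (\<Lambda> n)))"
        unfolding of_nat_add[symmetric] of_nat_le_iff by (rule orbit_count_le[OF p p' d fin])
      moreover have "?c p' n \<le> ?c p n + real (card (r_boundary adj \<rho> (\<Lambda> n)))"
        unfolding of_nat_add[symmetric] of_nat_le_iff
        by (rule orbit_count_le[OF p' p dist_le_sym[OF simple d] fin])
      ultimately have "\<bar>?c p n - ?c p' n\<bar> \<le> real (card (r_boundary adj \<rho> (\<Lambda> n)))" by linarith
      then show "norm ((?c p n - ?c p' n) / real (card (\<Lambda> n))) \<le> real (card (r_boundary adj \<rho> (\<Lambda> n))) / real (card (\<Lambda> n))"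
        by (simp add: divide_right_mono)
    qed
  qed
  have "filterlim (\<lambda>n. card (\<Lambda> n)) at_top sequentially" using \<Lambda> by (simp add: folner_van_hove_def)
  then have ev: "\<forall>\<^sub>F n in sequentially. card (\<Lambda> n) \<ge> 1" by (simp add: filterlim_at_top)
  have N: "card reps > 0" using finite_reps by (simp add: card_gt_0_iff)
  \<comment> \<open>Averaging the differences over all \<open>p'\<close> recovers the density of
    \<open>p\<close> minus \<open>1 / card reps\<close>, exactly so once \<open>\<Lambda> n\<close>
    is nonempty.\<close>
  have "(\<lambda>n. 1 / real (card reps) + (\<Sum>p'\<in>reps. (?c p n - ?c p' n) / real (card (\<Lambda> n))) / real (card reps))
      \<longlonglongrightarrow> 1 / real (card reps) + (\<Sum>p'\<in>reps. 0) / real (card reps)"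
    by (intro tendsto_intros tendsto_sum diff) (use N in auto)
  moreover have "\<forall>\<^sub>F n in sequentially. 1 / real (card reps) + (\<Sum>p'\<in>reps. (?c p n - ?c p' n) / real (card (\<Lambda> n))) / real (card reps)
      = ?c p n / real (card (\<Lambda> n))"
    using ev
  proof eventually_elim
    case (elim n)
    have "(\<Sum>p'\<in>reps. ?c p' n) = real (card (\<Lambda> n))"
      using sum_orbit_count[OF fin, of "\<lambda>_. 1 :: real" n] by simp
    then have "(\<Sum>p'\<in>reps. (?c p n - ?c p' n) / real (card (\<Lambda> n)))
        = (real (card reps) * ?c p n - real (card (\<Lambda> n))) / real (card (\<Lambda> n))"
      by (simp add: sum_divide_distrib[symmetric] sum_subtractf)
    then show ?case using N elim by (simp add: field_simps)
  qed
  ultimately show ?thesis by (simp add: tendsto_cong)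
qed

text \<open>An average over one period of the weights seen in balls of radius \<open>r\<close>. For
  small nonzero \<open>z\<close> its limit in \<open>r\<close> is the derivative of the limiting
  free energy.\<close>

definition local_weight :: "nat \<Rightarrow> complex \<Rightarrow> complex" where
  "local_weight r z = (\<Sum>p\<in>reps. vertex_weight adj (cball_graph r p) p z) / of_nat (card reps)"

text \<open>The three error terms pay for three replacements: \<Lambda> by a ball around interior
  vertices, the same around boundary vertices with only the trivial bound, and the orbit frequencies
  by equal ones.\<close>

lemma average_vertex_weight:
  assumes z: "z \<noteq> 0" "cmod z \<le> 1 / (4 * (real m + 1) * 2 ^ m)"
    and m: "m = (\<Sum>p\<in>F. card (nbrs adj p))" and \<Lambda>: "finite \<Lambda>" "\<Lambda> \<noteq> {}"
  shows "cmod ((\<Sum>v\<in>\<Lambda>. vertex_weight adj \<Lambda> v z) / of_nat (card \<Lambda>) - local_weight r z)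
    \<le> 4 / cmod z / 2 ^ r + 2 / cmod z * (real (card (r_boundary adj r \<Lambda>)) / real (card \<Lambda>))
      + (\<Sum>p\<in>reps. \<bar>real (card {v\<in>\<Lambda>. rep v = p}) / real (card \<Lambda>) - 1 / real (card reps)\<bar> * (1 / cmod z))"
proof -
  define N where "N = real (card \<Lambda>)"
  have N: "N > 0" using \<Lambda> by (simp add: N_def card_gt_0_iff)
  define a where "a = (\<lambda>v. vertex_weight adj (cball_graph r v) v z)"
  define c where "c = (\<lambda>p. real (card {v\<in>\<Lambda>. rep v = p}))"
  have fb: "finite (cball_graph r v)" for v using finite_dist_le[OF locfin] .
  note deg = degree_bound[folded m]
  note loc = vertex_weight_local[OF simple deg z(2,1)]
  \<comment> \<open>\<open>mover v\<close> carries the ball around \<open>rep v\<close> to the ball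
    around \<open>v\<close>, so the local weight depends only on the orbit.\<close>
  have a_rep: "a v = a (rep v)" for v
    using vertex_weight_automorphism[OF aut[OF mover(1)[of v]], of "cball_graph r (rep v)" "rep v" z]
      ball_automorphism[OF aut[OF mover(1)[of v]], of r "rep v"]
    by (simp add: a_def mover)
  have a_le: "cmod (a v) \<le> 1 / cmod z" for v
    unfolding a_def by (rule loc(1)) (use fb in auto)
  have "cmod ((\<Sum>v\<in>\<Lambda>. vertex_weight adj \<Lambda> v z) - (\<Sum>v\<in>\<Lambda>. a v))
      \<le> (\<Sum>v\<in>\<Lambda>. cmod (vertex_weight adj \<Lambda> v z - a v))"
    unfolding sum_subtractf[symmetric] by (rule norm_sum)
  also have "\<dots> \<le> (\<Sum>v\<in>\<Lambda>. 4 / cmod z / 2 ^ r + (if v \<in> r_boundary adj r \<Lambda> then 2 / cmod z else 0))"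
  proof (rule sum_mono)
    fix v assume v: "v \<in> \<Lambda>"
    show "cmod (vertex_weight adj \<Lambda> v z - a v)
        \<le> 4 / cmod z / 2 ^ r + (if v \<in> r_boundary adj r \<Lambda> then 2 / cmod z else 0)"
    proof (cases "v \<in> r_boundary adj r \<Lambda>")
      case True
      have "cmod (vertex_weight adj \<Lambda> v z - a v) \<le> cmod (vertex_weight adj \<Lambda> v z) + cmod (a v)"
        by (rule norm_triangle_ineq4)
      also have "\<dots> \<le> 1 / cmod z + 1 / cmod z"
        using loc(1)[OF \<Lambda>(1) v] a_le by (rule add_mono)
      also have "\<dots> \<le> 4 / cmod z / 2 ^ r + 2 / cmod z" by simp
      finally show ?thesis using True by simp
    next
      case False
      then have "u \<in> \<Lambda>" if "dist_le adj r v u" for u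
        using that v unfolding r_boundary_def by (auto intro: dist_le_refl)
      then have "cmod (vertex_weight adj \<Lambda> v z - a v) \<le> 4 / cmod z / 2 ^ r"
        unfolding a_def using fb by (intro loc(2)[OF \<Lambda>(1) v]) auto
      then show ?thesis using False by simp
    qed
  qed
  also have "\<dots> = N * (4 / cmod z / 2 ^ r) + real (card (\<Lambda> \<inter> r_boundary adj r \<Lambda>)) * (2 / cmod z)"
    using \<Lambda> by (simp add: sum.distrib sum.If_cases N_def)
  also have "\<dots> \<le> N * (4 / cmod z / 2 ^ r) + real (card (r_boundary adj r \<Lambda>)) * (2 / cmod z)"
    using finite_r_boundary[OF simple locfin \<Lambda>(1)]
    by (intro add_left_mono mult_right_mono) (auto intro: card_mono)
  finally have 1: "cmod ((\<Sum>v\<in>\<Lambda>. vertex_weight adj \<Lambda> v z) - (\<Sum>v\<in>\<Lambda>. a v))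
      \<le> N * (4 / cmod z / 2 ^ r) + real (card (r_boundary adj r \<Lambda>)) * (2 / cmod z)" .
  have "(\<Sum>v\<in>\<Lambda>. a v) = (\<Sum>v\<in>\<Lambda>. a (rep v))" using a_rep by (rule sum.cong[OF refl])
  also have "\<dots> = (\<Sum>p\<in>reps. of_real (c p) * a p)"
    unfolding c_def using sum_orbit_count[OF \<Lambda>(1), of a] by simp
  finally have "(\<Sum>v\<in>\<Lambda>. a v) / of_real N - local_weight r z
      = (\<Sum>p\<in>reps. of_real (c p / N - 1 / real (card reps)) * a p)"
    unfolding local_weight_def a_def[symmetric]
    by (simp add: sum_divide_distrib sum_subtractf[symmetric] algebra_simps)
  then have "cmod ((\<Sum>v\<in>\<Lambda>. a v) / of_real N - local_weight r z)
      \<le> (\<Sum>p\<in>reps. cmod (of_real (c p / N - 1 / real (card reps)) * a p))"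
    by (simp only: norm_sum)
  also have "\<dots> \<le> (\<Sum>p\<in>reps. \<bar>c p / N - 1 / real (card reps)\<bar> * (1 / cmod z))"
    unfolding norm_mult norm_of_real using a_le by (intro sum_mono mult_left_mono) auto
  finally have 2: "cmod ((\<Sum>v\<in>\<Lambda>. a v) / of_real N - local_weight r z)
      \<le> (\<Sum>p\<in>reps. \<bar>c p / N - 1 / real (card reps)\<bar> * (1 / cmod z))" .
  have "cmod (((\<Sum>v\<in>\<Lambda>. vertex_weight adj \<Lambda> v z) - (\<Sum>v\<in>\<Lambda>. a v)) / of_real N)
      \<le> (N * (4 / cmod z / 2 ^ r) + real (card (r_boundary adj r \<Lambda>)) * (2 / cmod z)) / N"
    using 1 N by (simp add: norm_divide divide_right_mono)
  also have "\<dots> = 4 / cmod z / 2 ^ r + 2 / cmod z * (real (card (r_boundary adj r \<Lambda>)) / N)"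
    using N by (simp add: add_divide_distrib)
  finally have 3: "cmod (((\<Sum>v\<in>\<Lambda>. vertex_weight adj \<Lambda> v z) - (\<Sum>v\<in>\<Lambda>. a v)) / of_real N)
      \<le> 4 / cmod z / 2 ^ r + 2 / cmod z * (real (card (r_boundary adj r \<Lambda>)) / N)" .
  have "(\<Sum>v\<in>\<Lambda>. vertex_weight adj \<Lambda> v z) / of_nat (card \<Lambda>) - local_weight r z
      = ((\<Sum>v\<in>\<Lambda>. vertex_weight adj \<Lambda> v z) - (\<Sum>v\<in>\<Lambda>. a v)) / of_real N
        + ((\<Sum>v\<in>\<Lambda>. a v) / of_real N - local_weight r z)"
    by (simp add: N_def diff_divide_distrib)
  then show ?thesis
    using norm_triangle_mono[OF 3 2] by (simp only: N_def c_def)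
qed

text \<open>Balls of radii \<open>r \<le> s\<close> agree within distance \<open>r\<close> of their
  centre, so locality gives the Cauchy property.\<close>

lemma local_weight_convergent:
  assumes z: "z \<noteq> 0" "cmod z \<le> 1 / (4 * (real m + 1) * 2 ^ m)"
    and m: "m = (\<Sum>p\<in>F. card (nbrs adj p))"
  shows "convergent (\<lambda>r. local_weight r z)"
proof -
  note deg = degree_bound[folded m]
  note loc = vertex_weight_local(2)[OF simple deg z(2,1)]
  have fb: "finite (cball_graph r v)" for r v using finite_dist_le[OF locfin] .
  have N: "card reps > 0" using finite_reps by (simp add: card_gt_0_iff)
  have d: "cmod (local_weight r z - local_weight s z) \<le> 4 / cmod z / 2 ^ r" if rs: "r \<le> s" for r s
  proof -
    have "cmod ((\<Sum>p\<in>reps. vertex_weight adj (cball_graph r p) p z) - (\<Sum>p\<in>reps. vertex_weight adj (cball_graph s p) p z))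
        \<le> (\<Sum>p\<in>reps. cmod (vertex_weight adj (cball_graph r p) p z - vertex_weight adj (cball_graph s p) p z))"
      unfolding sum_subtractf[symmetric] by (rule norm_sum)
    also have "\<dots> \<le> (\<Sum>p\<in>reps. 4 / cmod z / 2 ^ r)"
      using fb rs by (intro sum_mono loc) (auto intro: dist_le_mono)
    finally have "cmod ((\<Sum>p\<in>reps. vertex_weight adj (cball_graph r p) p z) - (\<Sum>p\<in>reps. vertex_weight adj (cball_graph s p) p z))
      / real (card reps) \<le> (real (card reps) * (4 / cmod z / 2 ^ r)) / real (card reps)"
      by (intro divide_right_mono) auto
    also have "\<dots> = 4 / cmod z / 2 ^ r" using N by simp
    finally show ?thesis
      unfolding local_weight_def diff_divide_distrib[symmetric] norm_divide norm_of_nat .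
  qed
  have "(\<lambda>r. 4 / cmod z / 2 ^ r) \<longlonglongrightarrow> 0"
    using tendsto_mult_right_zero[OF LIMSEQ_power_zero[of "1/2 :: real"], of "4 / cmod z"]
    by (simp add: power_one_over field_simps)
  have "Cauchy (\<lambda>r. local_weight r z)"
  proof (rule metric_CauchyI)
    fix e :: real assume e: "e > 0"
    from order_tendstoD(2)[OF \<open>(\<lambda>r. 4 / cmod z / 2 ^ r) \<longlonglongrightarrow> 0\<close>, of "e / 2"] e
    obtain M where M: "4 / cmod z / 2 ^ M < e / 2" unfolding eventually_sequentially by auto
    have "dist (local_weight r z) (local_weight s z) < e" if "M \<le> r" "M \<le> s" for r s
    proof -
      have "dist (local_weight r z) (local_weight s z) \<le> dist (local_weight M z) (local_weight r z) + dist (local_weight M z) (local_weight s z)"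
        by (rule dist_triangle3)
      also have "\<dots> \<le> 4 / cmod z / 2 ^ M + 4 / cmod z / 2 ^ M"
        unfolding dist_norm using d that by (intro add_mono) auto
      finally show ?thesis using M by simp
    qed
    then show "\<exists>M. \<forall>m\<ge>M. \<forall>n\<ge>M. dist (local_weight m z) (local_weight n z) < e" by blast
  qed
  then show ?thesis by (rule Cauchy_convergent)
qed

lemma average_vertex_weight_tendsto:
  assumes z: "z \<noteq> 0" "cmod z \<le> 1 / (4 * (real m + 1) * 2 ^ m)"
    and m: "m = (\<Sum>p\<in>F. card (nbrs adj p))" and \<Lambda>: "folner_van_hove adj \<Lambda>"
  shows "(\<lambda>n. (\<Sum>v\<in>\<Lambda> n. vertex_weight adj (\<Lambda> n) v z) / of_nat (card (\<Lambda> n)))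
    \<longlonglongrightarrow> lim (\<lambda>r. local_weight r z)"
proof -
  define L where "L = lim (\<lambda>r. local_weight r z)"
  have L: "(\<lambda>r. local_weight r z) \<longlonglongrightarrow> L"
    unfolding L_def using local_weight_convergent[OF z m] by (simp add: convergent_LIMSEQ_iff)
  define X where "X = (\<lambda>n. (\<Sum>v\<in>\<Lambda> n. vertex_weight adj (\<Lambda> n) v z) / of_nat (card (\<Lambda> n)))"
  define err where "err = (\<lambda>r n. 2 / cmod z * (real (card (r_boundary adj r (\<Lambda> n))) / real (card (\<Lambda> n)))
      + (\<Sum>p\<in>reps. \<bar>real (card {v\<in>\<Lambda> n. rep v = p}) / real (card (\<Lambda> n)) - 1 / real (card reps)\<bar> * (1 / cmod z)))"
  have fin: "finite (\<Lambda> n)" for n using \<Lambda> by (simp add: folner_van_hove_def)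
  have "filterlim (\<lambda>n. card (\<Lambda> n)) at_top sequentially" using \<Lambda> by (simp add: folner_van_hove_def)
  then have ev: "\<forall>\<^sub>F n in sequentially. card (\<Lambda> n) \<ge> 1" by (simp add: filterlim_at_top)
  have err: "err r \<longlonglongrightarrow> 0" for r
  proof -
    have bd: "(\<lambda>n. real (card (r_boundary adj r (\<Lambda> n))) / real (card (\<Lambda> n))) \<longlonglongrightarrow> 0"
      using \<Lambda> by (simp add: folner_van_hove_def)
    have "err r \<longlonglongrightarrow> 2 / cmod z * 0 + (\<Sum>p\<in>reps. \<bar>1 / real (card reps) - 1 / real (card reps)\<bar> * (1 / cmod z))"
      unfolding err_def by (intro tendsto_intros bd orbit_density[OF \<Lambda>])
    then show ?thesis by simp
  qed
  have pw: "(\<lambda>r. 4 / cmod z / 2 ^ r) \<longlonglongrightarrow> 0"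
    using tendsto_mult_right_zero[OF LIMSEQ_power_zero[of "1/2 :: real"], of "4 / cmod z"]
    by (simp add: power_one_over field_simps)
  have "X \<longlonglongrightarrow> L"
  proof (rule metric_LIMSEQ_I)
    fix e :: real assume e: "e > 0"
    have "\<forall>\<^sub>F r in sequentially. 4 / cmod z / 2 ^ r < e / 3 \<and> dist (local_weight r z) L < e / 3"
      using order_tendstoD(2)[OF pw, of "e / 3"] tendstoD[OF L, of "e / 3"] e by (auto intro: eventually_conj)
    then obtain r where r: "4 / cmod z / 2 ^ r < e / 3" "dist (local_weight r z) L < e / 3"
      unfolding eventually_sequentially by blast
    \<comment> \<open>The radius is fixed before \<open>n\<close> grows, because the boundary ratio
      vanishes for each fixed \<open>r\<close>, not uniformly in \<open>r\<close>.\<close>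
    have "\<forall>\<^sub>F n in sequentially. err r n < e / 3 \<and> card (\<Lambda> n) \<ge> 1"
      using order_tendstoD(2)[OF err[of r], of "e / 3"] e ev by (auto intro: eventually_conj)
    then have "\<forall>\<^sub>F n in sequentially. dist (X n) L < e"
    proof eventually_elim
      case (elim n)
      then have "\<Lambda> n \<noteq> {}" by auto
      then have "dist (X n) (local_weight r z) \<le> 4 / cmod z / 2 ^ r + err r n"
        unfolding X_def err_def dist_norm using average_vertex_weight[OF z m fin, of n r] by simp
      with dist_triangle[of "X n" L "local_weight r z"] r elim show ?case by linarith
    qed
    then show "\<exists>no. \<forall>n\<ge>no. dist (X n) L < e" by (simp add: eventually_sequentially)
  qed
  then show ?thesis by (simp add: X_def L_def)
qed

end

section \<open>The domain and the free energy on it\<close>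

text \<open>The neighbourhood is a Minkowski sum of a segment and a disc. Convexity makes it and its
  interior connected, as uniqueness of branches and the identity theorem require.\<close>

lemma convex_Ldelta: "convex (Ldelta \<delta> (real_interval lam))"
proof -
  have "Ldelta \<delta> (real_interval lam) = (\<Union>x\<in>real_interval lam. \<Union>y\<in>cball 0 \<delta>. {x + y})"
  proof -
    have "cmod (z - x) \<le> \<delta> \<longleftrightarrow> (\<exists>y\<in>cball 0 \<delta>. z = x + y)" for x z :: complex
    proof
      show "cmod (z - x) \<le> \<delta> \<Longrightarrow> \<exists>y\<in>cball 0 \<delta>. z = x + y"
        by (rule bexI[of _ "z - x"]) auto
    qed auto
    then show ?thesis by (auto simp: Ldelta_def)
  qed
  moreover have "convex (real_interval lam)"
    unfolding real_interval_def
    by (intro convex_linear_image bounded_linear.linear[OF bounded_linear_of_real]) auto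
  ultimately show ?thesis using convex_sums[OF _ convex_cball] by simp
qed

lemma ball_subset_interior_Ldelta:
  assumes "lam \<ge> 0"
  shows "ball 0 \<delta> \<subseteq> interior (Ldelta \<delta> (real_interval lam))"
proof (rule interior_maximal)
  have "0 \<in> real_interval lam" using assms by (auto simp: real_interval_def)
  then show "ball 0 \<delta> \<subseteq> Ldelta \<delta> (real_interval lam)"
    by (auto simp: Ldelta_def intro!: bexI[of _ 0])
qed simp

context periodic_graph
begin

lemma free_energy_on_Ldelta:
  assumes lam: "lam \<ge> 0" and \<delta>: "\<delta> > 0"
    and zf: "\<And>z. z \<in> Ldelta \<delta> (real_interval lam) \<Longrightarrow> zero_free_at adj C z"
  shows "free_energy_unique_analytic adj (Ldelta \<delta> (real_interval lam))"
proof -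
  define D where "D = Ldelta \<delta> (real_interval lam)"
  define S where "S = interior D"
  define m where "m = (\<Sum>p\<in>F. card (nbrs adj p))"
  define \<rho> where "\<rho> = min \<delta> (1 / (4 * (real m + 1) * 2 ^ m))"
  have \<rho>: "\<rho> > 0" using \<delta> by (simp add: \<rho>_def)
  have bS: "ball 0 \<rho> \<subseteq> S"
    using ball_subset_interior_Ldelta[OF lam, of \<delta>] by (auto simp: S_def D_def \<rho>_def)
  have S: "open S" "S \<subseteq> D" "connected S" "connected D"
    using convex_Ldelta[of \<delta> lam] unfolding S_def D_def
    by (auto simp: interior_subset convex_connected convex_interior)
  have D0: "0 \<in> D" using subsetD[OF bS, of 0] S(2) \<rho> by auto
  define branch where "branch = (\<lambda>\<Lambda> g. folner_van_hove adj \<Lambda> \<and>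
     (\<forall>n. continuous_on D (g n) \<and> g n 0 = 0 \<and> (\<forall>z\<in>D. exp (g n z) = partition_fun adj (\<Lambda> n) z)))"
  \<comment> \<open>Putting the branches of all sequences into one family makes the limit
    independent of the sequence.\<close>
  define H :: "(nat \<Rightarrow> complex \<Rightarrow> complex) set"
    where "H = {h. \<exists>\<Lambda> g. branch \<Lambda> g \<and> h = (\<lambda>n z. g n z / of_nat (card (\<Lambda> n)))}"
  define K where "K = ln 2 + \<bar>ln C\<bar> + pi"
  have K: "K \<ge> 0" by (simp add: K_def)
  have br: "g n holomorphic_on D" "\<And>z. z \<in> D \<Longrightarrow> cmod (g n z) \<le> real (card (\<Lambda> n)) * K"
    "g n 0 = 0" "\<And>z. z \<in> D \<Longrightarrow> exp (g n z) = partition_fun adj (\<Lambda> n) z" "finite (\<Lambda> n)"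
    if "branch \<Lambda> g" for \<Lambda> g n
  proof -
    have fin: "finite (\<Lambda> n)" and g: "continuous_on D (g n)" "g n 0 = 0"
      "\<And>z. z \<in> D \<Longrightarrow> exp (g n z) = partition_fun adj (\<Lambda> n) z"
      using that unfolding branch_def folner_van_hove_def by auto
    have zf': "zero_free_at adj C z" if "z \<in> D" for z using that zf by (simp add: D_def)
    show "g n holomorphic_on D" "\<And>z. z \<in> D \<Longrightarrow> cmod (g n z) \<le> real (card (\<Lambda> n)) * K"
      using log_partition_fun_branch[OF simple zf' fin S(4) D0 g] by (auto simp: K_def)
    show "g n 0 = 0" "\<And>z. z \<in> D \<Longrightarrow> exp (g n z) = partition_fun adj (\<Lambda> n) z" "finite (\<Lambda> n)"
      using fin g by auto
  qed
  have "\<exists>f. f holomorphic_on S \<and>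
    (\<forall>h\<in>H. \<forall>K. compact K \<and> K \<subseteq> S \<longrightarrow> uniform_limit K h f sequentially)"
  proof (rule vitali_common_limit[OF S(1,3) bS \<rho>])
    fix h assume "h \<in> H"
    then obtain \<Lambda> g where b: "branch \<Lambda> g" and h: "h = (\<lambda>n z. g n z / of_nat (card (\<Lambda> n)))"
      by (auto simp: H_def)
    have g_hol: "g n holomorphic_on S" for n
      using br(1)[OF b] S(2) holomorphic_on_subset by blast
    show "h n holomorphic_on S" for n
      unfolding h divide_inverse by (intro holomorphic_intros g_hol)
    show "h n 0 = 0" for n using br(3)[OF b] by (simp add: h)
    show "cmod (h n z) \<le> K" if "z \<in> S" for n z
    \<comment> \<open>Early members of the sequence may be empty; division by zero then gives the
      value 0.\<close>
    proof (cases "card (\<Lambda> n) = 0")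
      case False
      have "cmod (g n z) \<le> real (card (\<Lambda> n)) * K" using br(2)[OF b] that S(2) by blast
      then show ?thesis using False by (simp add: h norm_divide field_simps)
    qed (use K in \<open>simp add: h\<close>)
    fix z :: complex assume z: "z \<in> ball 0 \<rho> - {0}"
    then have z': "z \<noteq> 0" "cmod z \<le> 1 / (4 * (real m + 1) * 2 ^ m)" "z \<in> S"
      using bS by (auto simp: \<rho>_def)
    have "deriv (h n) z = (\<Sum>v\<in>\<Lambda> n. vertex_weight adj (\<Lambda> n) v z) / of_nat (card (\<Lambda> n))" for n
    proof -
      have "deriv (g n) z = (\<Sum>v\<in>\<Lambda> n. vertex_weight adj (\<Lambda> n) v z)"
        using br(4,5)[OF b] S(2)
        by (intro deriv_log_partition_fun[OF simple _ S(1) z'(3,1) g_hol]) auto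
      moreover have "(g n has_field_derivative deriv (g n) z) (at z)"
        using g_hol S(1) z'(3) by (rule holomorphic_derivI)
      then have "(h n has_field_derivative deriv (g n) z / of_nat (card (\<Lambda> n))) (at z)"
        unfolding h by (rule DERIV_cdivide)
      ultimately show ?thesis by (simp add: DERIV_imp_deriv)
    qed
    then show "(\<lambda>n. deriv (h n) z) \<longlonglongrightarrow> lim (\<lambda>r. local_weight r z)"
      using average_vertex_weight_tendsto[OF z'(1,2) m_def] b by (simp add: branch_def)
  qed
  then obtain f where f: "f holomorphic_on S"
    "\<And>h K. h \<in> H \<Longrightarrow> compact K \<Longrightarrow> K \<subseteq> S \<Longrightarrow> uniform_limit K h f sequentially" by blast
  have "f analytic_on S" using f(1) S(1) by (simp add: analytic_on_open)
  moreover have "uniform_limit K (\<lambda>n z. g n z / of_nat (card (\<Lambda> n))) f sequentially"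
    if "branch \<Lambda> g" "compact K" "K \<subseteq> S" for \<Lambda> g K
    using that by (intro f(2)) (auto simp: H_def)
  moreover have "partition_fun adj \<Lambda> z \<noteq> 0" if "finite \<Lambda>" "z \<in> D" for \<Lambda> z
    using zf[of z] that by (simp add: zero_free_at_def D_def)
  ultimately show ?thesis
    unfolding free_energy_unique_analytic_def D_def[symmetric] S_def[symmetric]
    unfolding branch_def by blast
qed

end

section \<open>From the assumptions to the parameters\<close>

lemma assumption_A_periodic_graph:
  assumes "assumption_A adj"
  obtains \<Gamma> F where "periodic_graph adj \<Gamma> F"
proof -
  have basic: "simple_graph adj" "graph_connected adj" "locally_finite adj"
    using assms by (auto simp only: assumption_A_def)
  have "\<exists>d \<tau>. (\<forall>i<d. graph_automorphism adj (\<tau> i)) \<and>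
      (\<forall>g\<in>gen_group \<tau> d. \<forall>v. g v = v \<longrightarrow> g = id) \<and>
      (\<exists>F. finite F \<and> UNIV = {g v | g v. g \<in> gen_group \<tau> d \<and> v \<in> F})"
    using assms unfolding assumption_A_def by (elim conjE exE) (intro exI conjI; assumption)
  then obtain d \<tau> where *: "(\<forall>i<d. graph_automorphism adj (\<tau> i)) \<and>
      (\<forall>g\<in>gen_group \<tau> d. \<forall>v. g v = v \<longrightarrow> g = id) \<and>
      (\<exists>F. finite F \<and> UNIV = {g v | g v. g \<in> gen_group \<tau> d \<and> v \<in> F})"
    by (elim exE)
  then obtain F where F: "finite F" "UNIV = {g v | g v. g \<in> gen_group \<tau> d \<and> v \<in> F}"
    by (elim conjE exE)
  have aut: "\<And>i. i < d \<Longrightarrow> graph_automorphism adj (\<tau> i)"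
    using conjunct1[OF *] by blast
  have free: "\<And>g v. g \<in> gen_group \<tau> d \<Longrightarrow> g v = v \<Longrightarrow> g = id"
    using conjunct1[OF conjunct2[OF *]] by blast
  have "periodic_graph adj (gen_group \<tau> d) F"
  proof
    fix g h v
    have "v \<in> {g v | g v. g \<in> gen_group \<tau> d \<and> v \<in> F}" unfolding F(2)[symmetric] by simp
    then show "\<exists>g\<in>gen_group \<tau> d. \<exists>p\<in>F. v = g p" by blast
    assume g: "g \<in> gen_group \<tau> d"
    show "graph_automorphism adj g" using aut g by (rule gen_group_automorphism)
    show "inv g \<in> gen_group \<tau> d" using aut g by (rule gen_group_inv)
    show "g v = v \<Longrightarrow> g = id" using g by (rule free)
    show "h \<in> gen_group \<tau> d \<Longrightarrow> g \<circ> h \<in> gen_group \<tau> d" using g by (rule gen_group_comp)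
  qed (fact basic F(1))+
  then show ?thesis by (rule that)
qed

lemma num_saw_growth:
  fixes adj :: "'a \<Rightarrow> 'a \<Rightarrow> bool"
  assumes deg: "\<And>v. finite (nbrs adj v)" "\<And>v. card (nbrs adj v) \<le> m"
    and \<mu>: "conn_const adj < ereal \<mu>" "1 \<le> \<mu>"
  shows "\<exists>C>0. \<forall>k v. real (num_saw adj k v) \<le> C * \<mu> ^ k"
proof -
  have "\<forall>\<^sub>F k in sequentially. sigma_k adj k < ereal \<mu>"
    using \<mu>(1) unfolding conn_const_def by (rule Limsup_lessD)
  then obtain K where K: "\<And>k. k \<ge> K \<Longrightarrow> sigma_k adj k < ereal \<mu>"
    unfolding eventually_sequentially by blast
  \<comment> \<open>\<open>C\<close> absorbs the finitely many short lengths through the degree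
    bound.\<close>
  define C where "C = (real m + 1) ^ Suc K"
  have C: "C \<ge> 1" unfolding C_def by (rule one_le_power) simp
  have "real (num_saw adj k v) \<le> C * \<mu> ^ k" for k v
  \<comment> \<open>\<open>Suc K\<close> keeps \<open>k\<close> positive: \<open>1 / real 0\<close>
    is 0, so \<open>sigma_k adj 0\<close> carries no information.\<close>
  proof (cases "k \<ge> Suc K")
    case True
    have "ereal (real (num_saw adj k v) powr (1 / real k)) \<le> sigma_k adj k"
      unfolding sigma_k_def by (rule SUP_upper) simp
    also have "\<dots> < ereal \<mu>" using K True by simp
    finally have "real (num_saw adj k v) powr (1 / real k) \<le> \<mu>" by simp
    then have "(real (num_saw adj k v) powr (1 / real k)) powr real k \<le> \<mu> powr real k"
      by (intro powr_mono2) auto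
    then have "real (num_saw adj k v) \<le> \<mu> ^ k"
      using True \<mu>(2) by (simp add: powr_powr powr_realpow)
    also have "\<dots> \<le> C * \<mu> ^ k" using C \<mu>(2) by simp
    finally show ?thesis .
  next
    case False
    have "real (num_saw adj k v) \<le> real m ^ k"
      using finite_saw_num_saw_le[of adj m k v, OF deg] by (metis of_nat_le_iff of_nat_power)
    also have "\<dots> \<le> (real m + 1) ^ k" by (intro power_mono) auto
    also have "\<dots> \<le> C" unfolding C_def using False by (intro power_increasing) auto
    also have "\<dots> \<le> C * \<mu> ^ k" using C \<mu>(2) by simp
    finally show ?thesis .
  qed
  then show ?thesis using C by (intro exI[of _ C]) auto
qed

text \<open>The room to the right of \<open>s\<close> lets a growth rate fit strictly between
  \<open>s\<close> and the branching \<open>x\<close> of the comparison tree.\<close>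

lemma lambda_c_greater_right:
  assumes "s > 1" "lam < lambda_c s"
  obtains x where "x > s" "lam < lambda_c x"
proof -
  have "isCont lambda_c s"
    unfolding lambda_c_def using assms(1) by (intro continuous_intros) auto
  then have "(lambda_c \<longlongrightarrow> lambda_c s) (at_right s)"
    unfolding isCont_def by (rule tendsto_mono[OF at_le, rotated]) simp
  then have "\<forall>\<^sub>F x in at_right s. lam < lambda_c x \<and> x > s"
    using order_tendstoD(1)[OF _ assms(2)] by (intro eventually_conj eventually_at_right_less) auto
  then obtain x where "lam < lambda_c x \<and> x > s"
    using eventually_happens trivial_limit_at_right_real by blast
  then show ?thesis using that by blast
qed

theorem theoremA1:
  fixes adj :: "'a \<Rightarrow> 'a \<Rightarrow> bool" and lam :: real
  assumes "assumption_A adj"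
    and "conn_const adj > 1"
    and "lam < lambda_c (real_of_ereal (conn_const adj))"
  shows "\<exists>\<delta>>0. free_energy_unique_analytic adj (Ldelta \<delta> (real_interval lam))"
proof (cases "lam < 0")
  case True
  \<comment> \<open>A negative \<open>lam\<close> empties the interval and hence the domain, so
    every requirement is vacuous.\<close>
  then have "Ldelta 1 (real_interval lam) = {}" by (simp add: Ldelta_def real_interval_def)
  then have "free_energy_unique_analytic adj (Ldelta 1 (real_interval lam))"
    unfolding free_energy_unique_analytic_def by (auto intro!: exI[of _ "\<lambda>_. 0"])
  then show ?thesis by (intro exI[of _ 1]) simp
next
  case False
  obtain \<Gamma> F where "periodic_graph adj \<Gamma> F" using assumption_A_periodic_graph[OF assms(1)] .
  then interpret periodic_graph adj \<Gamma> F .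
  \<comment> \<open>An infinite constant would be read as \<open>0\<close>, and \<open>lambda_c 0 = 0\<close>.\<close>
  obtain s where s: "conn_const adj = ereal s"
    using assms(2,3) False by (cases "conn_const adj") (auto simp: lambda_c_def)
  have s1: "s > 1" using assms(2) by (simp add: s one_ereal_def)
  obtain x where x: "x > s" "lam < lambda_c x"
    using lambda_c_greater_right[OF s1, of lam] assms(3) by (auto simp: s)
  \<comment> \<open>\<open>\<mu> > s\<close> gives the exponential bound on walks, and
    \<open>\<mu> < x\<close> the convergence of their weighted series for
    \<open>D + 1 = x\<close>.\<close>
  define \<mu> where "\<mu> = (s + x) / 2"
  have \<mu>: "s < \<mu>" "\<mu> < x" using x by (auto simp: \<mu>_def)
  obtain C where C: "C > 0" "\<And>k v. real (num_saw adj k v) \<le> C * \<mu> ^ k"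
    using num_saw_growth[where adj = adj and \<mu> = \<mu>, OF degree_bound] \<mu> s1 by (auto simp: s)
  have "\<exists>\<delta>>0. \<forall>z\<in>Ldelta \<delta> (real_interval lam). zero_free_at adj (2 * (1 + lam)) z"
    by (rule zero_free_neighbourhood[where D = "x - 1" and C = C and \<mu> = \<mu>, OF simple degree_bound])
       (use x s1 False C \<mu> in auto)
  then show ?thesis using free_energy_on_Ldelta False by (meson not_le_imp_less less_imp_le linorder_not_less)
qed

end
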